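(* Under the simple Hopf pair assumption of the context, assume $\sigma_{\mathrm H,c}^2=\lim_{\alpha\to\alpha_{\mathrm c}^-}\|B^\top\boldsymbol{w}_{\mathrm H}\|_2^2>0$. Let $\boldsymbol{x}=\boldsymbol{x}^*(\alpha)+\boldsymbol{z}$ with $\boldsymbol{z}\sim\mathcal{N}(\boldsymbol{0},C(\alpha))$ and $V=\frac{\|P\boldsymbol{x}\|^2}{N-1}$. With $\boldsymbol{p}_{\mathrm c}=\operatorname{Re}\boldsymbol{v}_{\mathrm H,c}$, $\boldsymbol{q}_{\mathrm c}=\operatorname{Im}\boldsymbol{v}_{\mathrm H,c}$, $\boldsymbol{v}_{\mathrm H,c}=\lim_{\alpha\to\alpha_{\mathrm c}^-}\boldsymbol{v}_{\mathrm H}(\alpha)$, let $$\mathcal{A}_{\mathrm H}=\begin{pmatrix}\|P\boldsymbol{p}_{\mathrm c}\|^2&(P\boldsymbol{p}_{\mathrm c})^\top(P\boldsymbol{q}_{\mathrm c})\\(P\boldsymbol{p}_{\mathrm c})^\top(P\boldsymbol{q}_{\mathrm c})&\|P\boldsymbol{q}_{\mathrm c}\|^2\end{pmatrix}.$$ Then, as $\alpha\to\alpha_{\mathrm c}^-$, $$\frac{\operatorname{sd}[V]}{\mathbb{E}[V]}\longrightarrow\frac{\sqrt{2\operatorname{Tr}(\mathcal{A}_{\mathrm H}^2)}}{\operatorname{Tr}(\mathcal{A}_{\mathrm H})}.$$ If the two eigenvalues of $\mathcal{A}_{\mathrm H}$ are denoted by $\nu_1$ and $\nu_2$, then the limit is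 $\dfrac{\sqrt{2(\nu_1^2+\nu_2^2)}}{\nu_1+\nu_2}$, and this limiting value lies between $1$ and $\sqrt2$.
   Context: Setting. $N\ge2$. Consider the It\^o SDE $\mathrm d\boldsymbol{x}=F(\boldsymbol{x};\alpha)\,\mathrm dt+B\,\mathrm d\boldsymbol{W}$ in $\mathbb{R}^N$, with $B\in\mathbb{R}^{N\times m}$ constant, $\boldsymbol{W}$ an $m$-dimensional standard Wiener process, and $F$ sufficiently smooth in $(\boldsymbol{x},\alpha)$ ($C^2$ in a neighborhood of the equilibrium branch, including its endpoint at $\alpha_{\mathrm c}$, suffices). $\boldsymbol{x}^*(\alpha)$ is a branch of equilibria, asymptotically stable for $\alpha<\alpha_{\mathrm c}$; $M(\alpha)=-\frac{\partial F}{\partial\boldsymbol{x}}\big|_{\boldsymbol{x}=\boldsymbol{x}^*(\alpha)}$; $C(\alpha)$ solves $MC+CM^\top=BB^\top$. Simple Hopf pair assumption. $\boldsymbol{x}^*(\alpha)$ has a finite limit $\boldsymbol{x}^*_{\mathrm c}$ as $\alpha\to\alpha_{\mathrm c}^-$. For $\alpha<\alpha_{\mathrm c}$ close to $\alpha_{\mathrm c}$, the real matrix $M(\alpha)$ is diagonalizable over $\mathbb{C}$ and has a simple complex-conjugate eigenvalue pair $\lambda_\pm(\alpha)=\eta(\alpha)\pm\mathrm i\,\Omega(\alpha)$ with $\eta(\alpha)>0$, $\eta(\alpha)\to0$, $\Omega(\alpha)\to\Omega_{\mathrm c}>0$; all other eigenvalues satisfy $\operatorname{Re}\lambda_k(\alpha)\ge\delta>0$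 with $\delta$ independent of $\alpha$. $\boldsymbol{v}_{\mathrm H},\overline{\boldsymbol{v}_{\mathrm H}}$ are right eigenvectors for $\lambda_+,\lambda_-$ and $\boldsymbol{w}_{\mathrm H},\overline{\boldsymbol{w}_{\mathrm H}}$ the corresponding left eigenvectors ($\boldsymbol{w}_{\mathrm H}^\top M=\lambda_+\boldsymbol{w}_{\mathrm H}^\top$), with $\|\boldsymbol{v}_{\mathrm H}\|_2=1$, $\boldsymbol{w}_{\mathrm H}^\top\boldsymbol{v}_{\mathrm H}=1$, $\boldsymbol{w}_{\mathrm H}^\top\overline{\boldsymbol{v}_{\mathrm H}}=0$ (plain transpose, no conjugation). $\boldsymbol{v}_{\mathrm H}$ and $\boldsymbol{w}_{\mathrm H}$ have finite limits as $\alpha\to\alpha_{\mathrm c}^-$. Notation: $P=I-\frac1N\boldsymbol{1}\boldsymbol{1}^\top$; $\operatorname{sd}[V]$ is the probabilistic standard deviation of $V$ over the law of $\boldsymbol{z}$; $V$ is the sample variance of the components of $\boldsymbol{x}$. *)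

theory Defs
  imports "HOL-Probability.Probability" "HOL-Computational_Algebra.Polynomial"
begin

definition C2_on :: "('a::real_normed_vector \<Rightarrow> 'b::real_normed_vector) \<Rightarrow> 'a set \<Rightarrow> bool" where
  "C2_on f U \<longleftrightarrow> open U \<and>
     (\<exists>(f' :: 'a \<Rightarrow> 'a \<Rightarrow>\<^sub>L 'b) (f'' :: 'a \<Rightarrow> 'a \<Rightarrow>\<^sub>L 'a \<Rightarrow>\<^sub>L 'b).
        (\<forall>p\<in>U. (f has_derivative blinfun_apply (f' p)) (at p)) \<and>
        (\<forall>p\<in>U. (f' has_derivative blinfun_apply (f'' p)) (at p)) \<and>
        continuous_on U f'')"

definition ode_solution_on :: "('a::real_normed_vector \<Rightarrow> 'a) \<Rightarrow> (real \<Rightarrow> 'a) \<Rightarrow> real set \<Rightarrow> bool" where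
  "ode_solution_on f u I \<longleftrightarrow> (\<forall>t\<in>I. (u has_vector_derivative f (u t)) (at t within I))"

text \<open>Lyapunov stability together with local attractivity. Stability is tested on every finite
  time interval on which a solution exists, so no global existence of solutions is presupposed.\<close>

definition asymptotically_stable :: "('a::real_normed_vector \<Rightarrow> 'a) \<Rightarrow> 'a \<Rightarrow> bool" where
  "asymptotically_stable f x \<longleftrightarrow>
     (\<forall>\<epsilon>>0. \<exists>\<delta>>0. \<forall>u T. 0 < T \<and> ode_solution_on f u {0..T} \<and> dist (u 0) x < \<delta> \<longrightarrow>
        (\<forall>t\<in>{0..T}. dist (u t) x < \<epsilon>)) \<and>
     (\<exists>\<delta>>0. \<forall>u. ode_solution_on f u {0..} \<and> dist (u 0) x < \<delta> \<longrightarrow> (u \<longlongrightarrow> x) at_top)"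

definition drift_matrix ::
    "(real^'n \<Rightarrow> real \<Rightarrow> real^'n) \<Rightarrow> (real \<Rightarrow> real^'n) \<Rightarrow> real \<Rightarrow> real^'n^'n" where
  "drift_matrix F xs \<alpha> = - jacobian (\<lambda>x. F x \<alpha>) (at (xs \<alpha>))"

definition cmat :: "real^'n^'m \<Rightarrow> complex^'n^'m" where
  "cmat A = map_matrix complex_of_real A"

definition cnj_vec :: "complex^'n \<Rightarrow> complex^'n" where
  "cnj_vec v = (\<chi> i. cnj (v $ i))"

text \<open>The plain transpose product; the library's inner product on \<^typ>\<open>complex^'n\<close> is real-valued.\<close>

definition tdot :: "complex^'n \<Rightarrow> complex^'n \<Rightarrow> complex" where
  "tdot w v = (\<Sum>i\<in>UNIV. w $ i * v $ i)"

definition right_eigenvector :: "'a::field^'n^'n \<Rightarrow> 'a \<Rightarrow> 'a^'n \<Rightarrow> bool" where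
  "right_eigenvector A \<mu> v \<longleftrightarrow> v \<noteq> 0 \<and> A *v v = \<mu> *s v"

definition left_eigenvector :: "'a::field^'n^'n \<Rightarrow> 'a \<Rightarrow> 'a^'n \<Rightarrow> bool" where
  "left_eigenvector A \<mu> w \<longleftrightarrow> w \<noteq> 0 \<and> w v* A = \<mu> *s w"

definition eigenvalue :: "'a::field^'n^'n \<Rightarrow> 'a \<Rightarrow> bool" where
  "eigenvalue A \<mu> \<longleftrightarrow> (\<exists>v. right_eigenvector A \<mu> v)"

definition charpoly :: "'a::field^'n^'n \<Rightarrow> 'a poly" where
  "charpoly A = det (mat [:0, 1:] - map_matrix (\<lambda>a. [:a:]) A)"

text \<open>Simplicity is meant algebraically: a simple root of the characteristic polynomial.\<close>

definition simple_eigenvalue :: "'a::field^'n^'n \<Rightarrow> 'a \<Rightarrow> bool" where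
  "simple_eigenvalue A \<mu> \<longleftrightarrow> eigenvalue A \<mu> \<and> order \<mu> (charpoly A) = 1"

definition diagonalizable :: "'a::field^'n^'n \<Rightarrow> bool" where
  "diagonalizable A \<longleftrightarrow>
     (\<exists>(S :: 'a^'n^'n) D. invertible S \<and> (\<forall>i j. i \<noteq> j \<longrightarrow> D $ i $ j = 0) \<and> A ** S = S ** D)"

definition normal_law :: "real \<Rightarrow> real \<Rightarrow> real measure" where
  "normal_law m s2 =
     (if s2 = 0 then return borel m
      else density lborel (\<lambda>x. ennreal (normal_density m (sqrt s2) x)))"

text \<open>The law \<open>N(\<mu>, \<Sigma>)\<close>, characterised by its one-dimensional projections; \<open>\<Sigma>\<close> may be singular.\<close>

definition gaussian_vector ::
    "'a measure \<Rightarrow> ('a \<Rightarrow> real^'n) \<Rightarrow> real^'n \<Rightarrow> real^'n^'n \<Rightarrow> bool" where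
  "gaussian_vector Q z \<mu> \<Sigma> \<longleftrightarrow>
     prob_space Q \<and> z \<in> borel_measurable Q \<and>
     transpose \<Sigma> = \<Sigma> \<and> (\<forall>a. 0 \<le> a \<bullet> (\<Sigma> *v a)) \<and>
     (\<forall>a. distr Q borel (\<lambda>\<omega>. a \<bullet> z \<omega>) = normal_law (a \<bullet> \<mu>) (a \<bullet> (\<Sigma> *v a)))"

definition sd :: "'a measure \<Rightarrow> ('a \<Rightarrow> real) \<Rightarrow> real" where
  "sd Q X = sqrt (prob_space.variance Q X)"

definition centering :: "real^'n^'n" where
  "centering = mat 1 - (\<chi> i j. 1 / real CARD('n))"

definition sample_variance :: "real^'n \<Rightarrow> real" where
  "sample_variance x = (norm (centering *v x))\<^sup>2 / (real CARD('n) - 1)"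

definition Re_vec :: "complex^'n \<Rightarrow> real^'n" where
  "Re_vec v = (\<chi> i. Re (v $ i))"

definition Im_vec :: "complex^'n \<Rightarrow> real^'n" where
  "Im_vec v = (\<chi> i. Im (v $ i))"

definition hopf_gram :: "complex^'n \<Rightarrow> real^2^2" where
  "hopf_gram v =
     (let Pp = centering *v Re_vec v; Pq = centering *v Im_vec v
      in vector [vector [(norm Pp)\<^sup>2, Pp \<bullet> Pq], vector [Pp \<bullet> Pq, (norm Pq)\<^sup>2]])"

end

theory Submission
  imports Defs
begin

text \<open>As \<open>\<alpha> \<rightarrow> \<alpha>c\<close>, the rescaled covariance \<open>\<eta> C\<close> converges to \<open>\<sigma>2 (p p\<^sup>T + q q\<^sup>T)\<close>, where
  \<open>p + i q\<close> is the critical eigenvector. On the Hopf plane this follows by testing the Lyapunov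
  equation with the left eigenvectors. With \<open>R\<close> the complementary spectral projection, \<open>R C R\<^sup>T\<close>
  solves a Lyapunov equation with bounded right-hand side; diagonalizability enters only through the
  polynomial in \<open>M\<close> with roots in \<open>{Re \<ge> \<delta>}\<close> that annihilates \<open>R\<close>, and a compactness argument over all
  matrices and roots subject to this closed constraint bounds \<open>R C R\<^sup>T\<close> uniformly, so that no control
  of the eigenbasis is needed. The mean and the variance of the sample variance are polynomials in
  the entries of \<open>P C P\<^sup>T\<close> and in \<open>P x\<close>; after multiplication by \<open>\<eta>\<close> and \<open>\<eta>\<^sup>2\<close> the terms with
  \<open>P x\<close> vanish in the limit, and the remaining ones are the traces of the Gram matrix and of its
  square.\<close>

section \<open>Lyapunov equations with spectral constraints\<close>

lemma mat_mult_component: "(mat c ** X) $ i $ j = c * X $ i $ j"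
  for X :: "'a::comm_semiring_1^'k^'n"
  by (simp add: matrix_matrix_mult_def mat_def if_distrib[of "\<lambda>t. t * _"] cong: if_cong)

lemma mult_mat_component: "(X ** mat c) $ i $ j = X $ i $ j * c"
  for X :: "'a::comm_semiring_1^'n^'k"
  by (simp add: matrix_matrix_mult_def mat_def if_distrib cong: if_cong)

lemma mat_matrix_commute: "mat c ** X = X ** mat c"
  for X :: "'a::comm_semiring_1^'n^'n"
  by (simp add: vec_eq_iff mat_mult_component mult_mat_component mult.commute)

lemma matrix_diff_ldistrib: "A ** (B - C) = A ** B - A ** C"
  for A :: "'a::comm_ring_1^'n^'m" and B :: "'a^'k^'n"
  by (simp add: matrix_matrix_mult_def vec_eq_iff right_diff_distrib sum_subtractf)

lemma matrix_diff_rdistrib: "(B - C) ** A = B ** A - C ** A"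
  for B :: "'a::comm_ring_1^'n^'m" and A :: "'a^'k^'n"
  by (simp add: matrix_matrix_mult_def vec_eq_iff left_diff_distrib sum_subtractf)

lemma matrix_add_rdistrib: "(B + C) ** A = B ** A + C ** A"
  for B :: "'a::comm_ring_1^'n^'m" and A :: "'a^'k^'n"
  by (simp add: matrix_matrix_mult_def vec_eq_iff distrib_right sum.distrib)

lemma transpose_diff: "transpose (A - B) = transpose A - transpose B"
  by (simp add: transpose_def vec_eq_iff)

lemma inner_matrix_vector_commute:
  fixes C :: "real^'n^'n"
  assumes "transpose C = C"
  shows "a \<bullet> (C *v b) = b \<bullet> (C *v a)"
  by (metis assms dot_lmul_matrix inner_commute transpose_matrix_vector)

text \<open>A polynomial evaluated at \<open>M\<close>, given by its list of roots. Roots as data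
  can vary continuously together with \<open>M\<close>. The head factor stands rightmost, hence acts
  first on whatever is multiplied from the right, which suits induction over the list.\<close>

fun root_matrix :: "'a::comm_ring_1^'n^'n \<Rightarrow> 'a list \<Rightarrow> 'a^'n^'n" where
  "root_matrix M [] = mat 1"
| "root_matrix M (d # ds) = root_matrix M ds ** (M - mat d)"

lemma root_matrix_eigenvector:
  fixes M :: "'a::comm_ring_1^'n^'n"
  assumes "M *v s = \<mu> *s s"
  shows "root_matrix M ds *v s = (\<Prod>d\<leftarrow>ds. \<mu> - d) *s s"
proof (induction ds)
  case (Cons d ds)
  have "(M - mat d) *v s = (\<mu> - d) *s s"
  proof -
    have "mat d *v s = d *s s"
      by (simp add: vec_eq_iff matrix_vector_mult_def mat_def if_distrib[of "\<lambda>t. t * _"] cong: if_cong)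
    thus ?thesis
      by (simp add: matrix_vector_mult_diff_rdistrib assms vector_sub_rdistrib)
  qed
  hence "root_matrix M (d # ds) *v s = root_matrix M ds *v ((\<mu> - d) *s s)"
    by (simp flip: matrix_vector_mul_assoc)
  also have "\<dots> = (\<mu> - d) *s (root_matrix M ds *v s)"
    by (simp add: vec_eq_iff matrix_vector_mult_def sum_distrib_left mult.left_commute del: vector_sub_rdistrib)
  finally show ?case by (simp add: Cons.IH vec_eq_iff)
qed simp

text \<open>The hypothesis makes every row of \<open>X\<close> an eigenvector of \<open>M\<close>
  for \<mu>, so a polynomial in \<open>M\<close> acts on the rows by its value at \<mu>.\<close>

lemma mult_transpose_root_matrix:
  fixes M :: "'a::comm_ring_1^'n^'n"
  assumes "X ** transpose M = mat \<mu> ** X"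
  shows "X ** transpose (root_matrix M ds) = mat (\<Prod>d\<leftarrow>ds. \<mu> - d) ** X"
proof (induction ds)
  case (Cons d ds)
  have "X ** transpose (M - mat d) = mat (\<mu> - d) ** X"
    by (simp add: transpose_diff matrix_diff_ldistrib assms)
      (simp add: vec_eq_iff mat_mult_component mult_mat_component left_diff_distrib mult.commute)
  hence "X ** transpose (root_matrix M (d # ds)) = mat (\<mu> - d) ** (X ** transpose (root_matrix M ds))"
    by (simp add: matrix_transpose_mul matrix_mul_assoc)
  thus ?case by (simp add: Cons.IH vec_eq_iff mat_mult_component)
qed simp

text \<open>The roots are stripped off one at a time: as \<open>(M - d) X = 0\<close> by induction, the columns of
  \<open>X\<close> are eigenvectors of \<open>M\<close> for \<open>d\<close> and, by the equation, its rows are eigenvectors for \<open>-d\<close>.\<close>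

lemma sylvester_injective:
  fixes M X :: "'a::field^'n^'n"
  assumes "M ** X + X ** transpose M = 0" "root_matrix M ds ** X = 0"
    and "X ** transpose (root_matrix M es) = 0"
    and "\<And>d e. d \<in> set ds \<Longrightarrow> e \<in> set es \<Longrightarrow> d + e \<noteq> 0"
  shows "X = 0"
  using assms
proof (induction ds arbitrary: X)
  case (Cons d ds)
  define Y where "Y = (M - mat d) ** X"
  have comm: "M ** (M - mat d) = (M - mat d) ** M"
    by (simp add: matrix_diff_ldistrib matrix_diff_rdistrib mat_matrix_commute)
  have "M ** Y + Y ** transpose M = (M - mat d) ** (M ** X + X ** transpose M)"
    unfolding Y_def by (simp add: matrix_add_ldistrib matrix_mul_assoc comm)
  hence "M ** Y + Y ** transpose M = 0" by (simp only: Cons.prems(1) times0_right)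
  moreover have "root_matrix M ds ** Y = 0"
    using Cons.prems(2) by (simp add: Y_def matrix_mul_assoc)
  moreover have "Y ** transpose (root_matrix M es) = 0"
    unfolding Y_def by (simp add: Cons.prems(3) flip: matrix_mul_assoc)
  ultimately have "Y = 0"
    by (rule Cons.IH) (simp add: Cons.prems(4))
  hence "M ** X = mat d ** X" by (simp add: Y_def matrix_diff_rdistrib)
  hence "X ** transpose M = mat (- d) ** X"
    using Cons.prems(1) by (simp add: vec_eq_iff mat_mult_component eq_neg_iff_add_eq_0 add.commute)
  \<comment> \<open>The right annihilation now says that \<open>X\<close> times a scalar vanishes.
    The scalar is the product of the numbers -(d + e), none of which is zero.\<close>
  from mult_transpose_root_matrix[OF this, of es] Cons.prems(3)
  have "mat (\<Prod>e\<leftarrow>es. - d - e) ** X = 0" by simp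
  moreover have "(\<Prod>e\<leftarrow>es. - d - e) \<noteq> 0"
  proof -
    have "- d - e \<noteq> 0" if "e \<in> set es" for e
    proof -
      have "- d - e = - (d + e)" by simp
      thus ?thesis using Cons.prems(4)[of d e] that by (simp only: neg_equal_0_iff_equal) simp
    qed
    thus ?thesis by (auto simp: prod_list_zero_iff)
  qed
  ultimately show "X = 0"
    by (simp add: vec_eq_iff mat_mult_component)
qed simp

section \<open>Continuity and the uniform bound by compactness\<close>

lemma continuous_on_matrix_mult [continuous_intros]:
  fixes f :: "'x::topological_space \<Rightarrow> 'a::real_normed_algebra_1^'n^'m" and g :: "'x \<Rightarrow> 'a^'k^'n"
  assumes "continuous_on S f" "continuous_on S g"
  shows "continuous_on S (\<lambda>x. f x ** g x)"
  unfolding matrix_matrix_mult_def by (intro continuous_intros assms)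

lemma continuous_on_transpose [continuous_intros]:
  fixes f :: "'x::topological_space \<Rightarrow> 'a::real_normed_vector^'n^'m"
  assumes "continuous_on S f"
  shows "continuous_on S (\<lambda>x. transpose (f x))"
  unfolding transpose_def by (intro continuous_intros assms)

text \<open>The roots are read off a vector along a fixed index list, so that they range over a
  finite-dimensional space, where closed and bounded sets are compact.\<close>

lemma continuous_on_root_matrix [continuous_intros]:
  fixes f :: "'x::topological_space \<Rightarrow> 'a::{real_normed_algebra_1,comm_ring_1}^'n^'n"
    and g :: "'x \<Rightarrow> 'a^'n"
  assumes "continuous_on S f" "continuous_on S g"
  shows "continuous_on S (\<lambda>x. root_matrix (f x) (map (($) (g x)) js))"
proof (induction js)
  case (Cons j js)
  have "continuous_on S (\<lambda>x. mat (g x $ j) :: 'a^'n^'n)"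
    unfolding mat_def
  proof (intro continuous_on_vec_lambda)
    fix i k :: 'n
    show "continuous_on S (\<lambda>x. if i = k then g x $ j else 0)"
      by (cases "i = k") (auto intro!: continuous_intros assms)
  qed
  thus ?case by (auto intro!: continuous_intros assms Cons)
qed simp

text \<open>The bound is uniform although neither the diagonalizing basis nor the spectral projections
  of \<open>M\<close> are controlled: the annihilation conditions are closed and hence survive in the limit.\<close>

lemma lyapunov_uniform_bound:
  fixes js :: "'n::finite list"
  assumes "0 < \<delta>"
  obtains c where "\<And>(M :: complex^'n^'n) d X. \<lbrakk>norm M \<le> m; norm d \<le> m; \<forall>i. \<delta> \<le> Re (d $ i);
      root_matrix M (map (($) d) js) ** X = 0;
      X ** transpose (root_matrix M (map (($) d) js)) = 0\<rbrakk>
    \<Longrightarrow> norm X \<le> c * norm (M ** X + X ** transpose M)"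
proof -
  define S where "S = {(M :: complex^'n^'n, d :: complex^'n, X :: complex^'n^'n).
     norm M \<le> m \<and> norm d \<le> m \<and> (\<forall>i. \<delta> \<le> Re (d $ i)) \<and> norm X = 1 \<and>
     root_matrix M (map (($) d) js) ** X = 0 \<and> X ** transpose (root_matrix M (map (($) d) js)) = 0}"
  define g where "g = (\<lambda>(M :: complex^'n^'n, d :: complex^'n, X :: complex^'n^'n).
     norm (M ** X + X ** transpose M))"
  have "compact S"
  proof -
    have "closed S"
      unfolding S_def case_prod_unfold
      by (intro closed_Collect_conj closed_Collect_le closed_Collect_eq closed_Collect_all
          continuous_intros)
    moreover have "S \<subseteq> cball 0 m \<times> cball 0 m \<times> cball 0 1"
      by (auto simp: S_def)
    hence "bounded S"
      by (rule bounded_subset[rotated]) (intro bounded_Times bounded_cball)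
    ultimately show ?thesis by (simp add: compact_eq_bounded_closed)
  qed
  have cont: "continuous_on S g"
    unfolding g_def case_prod_unfold by (intro continuous_intros)
  have pos: "0 < g x" if "x \<in> S" for x
  proof -
    obtain M d X where x: "x = (M, d, X)" by (cases x)
    have "M ** X + X ** transpose M \<noteq> 0"
    proof
      assume "M ** X + X ** transpose M = 0"
      moreover have "d $ i + d $ j \<noteq> 0" for i j
      proof -
        have "\<delta> \<le> Re (d $ i)" "\<delta> \<le> Re (d $ j)" using that by (auto simp: x S_def)
        hence "0 < Re (d $ i + d $ j)" using assms by simp
        thus ?thesis by (metis less_irrefl zero_complex.sel(1))
      qed
      ultimately have "X = 0"
        using that by (intro sylvester_injective[of M X "map (($) d) js" "map (($) d) js"])
          (auto simp: x S_def)
      thus False using that by (simp add: x S_def)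
    qed
    thus ?thesis by (simp add: x g_def)
  qed
  \<comment> \<open>The positive function \<open>g\<close> attains its minimum on the compact set
    \<open>S\<close>, and this minimum serves as \<open>k\<close>. If \<open>S\<close> is empty, any
    positive number does.\<close>
  obtain k where k: "0 < k" "\<And>x. x \<in> S \<Longrightarrow> k \<le> g x"
  proof (cases "S = {}")
    case True
    thus thesis using that[of 1] by simp
  next
    case False
    from continuous_attains_inf[OF \<open>compact S\<close> False cont] pos show thesis
      using that by blast
  qed
  show thesis
  proof (rule that[of "1 / k"])
    fix M :: "complex^'n^'n" and d :: "complex^'n" and X :: "complex^'n^'n"
    assume *: "norm M \<le> m" "norm d \<le> m" "\<forall>i. \<delta> \<le> Re (d $ i)"
      "root_matrix M (map (($) d) js) ** X = 0"
      "X ** transpose (root_matrix M (map (($) d) js)) = 0"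
    have scale: "A ** (r *\<^sub>R Y) = r *\<^sub>R (A ** Y)" "(r *\<^sub>R Y) ** A = r *\<^sub>R (Y ** A)"
      for A Y :: "complex^'n^'n" and r :: real
      by (simp_all add: vec_eq_iff matrix_matrix_mult_def scaleR_sum_right)
    show "norm X \<le> 1 / k * norm (M ** X + X ** transpose M)"
    proof (cases "X = 0")
      case False
      \<comment> \<open>Both sides of the bound are homogeneous in \<open>X\<close>, so the unit
        sphere suffices.\<close>
      define Y where "Y = (1 / norm X) *\<^sub>R X"
      have "(M, d, Y) \<in> S"
        using * False by (simp add: S_def Y_def scale)
      from k(2)[OF this] have "k \<le> norm ((1 / norm X) *\<^sub>R (M ** X + X ** transpose M))"
        by (simp add: g_def Y_def scale scaleR_add_right)
      hence "k \<le> norm (M ** X + X ** transpose M) / norm X"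
        by (simp only: norm_scaleR) simp
      thus ?thesis using False k(1) by (simp add: field_simps)
    qed (use k in simp)
  qed
qed

section \<open>Diagonalizable matrices with a simple eigenvalue pair\<close>

lemma map_matrix_const_poly_mult:
  "map_matrix (\<lambda>a. [:a:]) (A ** B) = map_matrix (\<lambda>a. [:a:]) A ** map_matrix (\<lambda>a. [:a:]) B"
  for A :: "'a::comm_ring_1^'n^'m" and B :: "'a^'k^'n"
proof -
  have "[:sum f UNIV:] = (\<Sum>k\<in>UNIV. [:f k:])" for f :: "'n \<Rightarrow> 'a"
    by (simp add: poly_eq_iff coeff_sum coeff_pCons split: nat.splits)
  thus ?thesis by (simp add: vec_eq_iff matrix_matrix_mult_def mult.commute)
qed

text \<open>The similarity is lifted to matrices over the polynomial ring. There the determinant of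
  the lifted \<open>S\<close> is a unit, hence nonzero, and cancels because the ring has no zero
  divisors.\<close>

lemma charpoly_diagonalization:
  fixes A S D :: "'a::field^'n^'n"
  assumes "invertible S" "\<And>i j. i \<noteq> j \<Longrightarrow> D $ i $ j = 0" "A ** S = S ** D"
  shows "charpoly A = (\<Prod>i\<in>UNIV. [:- D $ i $ i, 1:])"
proof -
  let ?c = "map_matrix (\<lambda>a. [:a:]) :: 'a^'n^'n \<Rightarrow> 'a poly^'n^'n"
  obtain S' where S': "S ** S' = mat 1"
    using assms(1) by (auto simp: invertible_def)
  have "?c (mat 1) = mat 1" by (simp add: vec_eq_iff mat_def one_pCons)
  hence "?c S ** ?c S' = mat 1" using S' by (simp flip: map_matrix_const_poly_mult)
  hence "det (?c S) * det (?c S') = 1" by (simp flip: det_mul)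
  hence nz: "det (?c S) \<noteq> 0" by auto
  have "?c A ** ?c S = ?c S ** ?c D"
    by (simp add: assms(3) flip: map_matrix_const_poly_mult)
  hence "(mat [:0, 1:] - ?c A) ** ?c S = ?c S ** (mat [:0, 1:] - ?c D)"
    by (simp only: matrix_diff_ldistrib matrix_diff_rdistrib mat_matrix_commute)
  hence "charpoly A * det (?c S) = det (?c S) * det (mat [:0, 1:] - ?c D)"
    unfolding charpoly_def by (simp only: flip: det_mul)
  hence "charpoly A = det (mat [:0, 1:] - ?c D)" using nz by simp
  also have "\<dots> = (\<Prod>i\<in>UNIV. [:- D $ i $ i, 1:])"
    by (subst det_diagonal) (auto simp: mat_def assms(2))
  finally show ?thesis .
qed

text \<open>Two indices sharing the root would make the square of its linear factor a divisor of the
  product. This turns algebraic simplicity into uniqueness of a diagonal entry.\<close>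

lemma simple_root_unique_index:
  fixes f :: "'n::finite \<Rightarrow> 'a::field"
  assumes "order \<mu> (\<Prod>i\<in>UNIV. [:- f i, 1:]) = 1" "f i = \<mu>" "f j = \<mu>"
  shows "i = j"
proof (rule ccontr)
  let ?p = "\<Prod>i\<in>UNIV. [:- f i, 1:]"
  assume "i \<noteq> j"
  have "?p = [:- f i, 1:] * ([:- f j, 1:] * (\<Prod>k\<in>UNIV - {i} - {j}. [:- f k, 1:]))"
    using \<open>i \<noteq> j\<close> by (subst prod.remove[of _ i], simp, simp, subst prod.remove[of _ j]) auto
  hence "?p = [:- \<mu>, 1:] ^ 2 * (\<Prod>k\<in>UNIV - {i} - {j}. [:- f k, 1:])"
    by (simp only: assms(2,3) mult.assoc power2_eq_square)
  hence "[:- \<mu>, 1:] ^ 2 dvd ?p" by (rule dvdI)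
  moreover have "?p \<noteq> 0" by (simp add: prod_zero_iff)
  ultimately have "2 \<le> order \<mu> ?p" by (simp add: order_divides)
  thus False using assms(1) by simp
qed

lemma diagonalization_column:
  fixes A S D :: "'a::field^'n^'n"
  assumes "\<And>i j. i \<noteq> j \<Longrightarrow> D $ i $ j = 0" "A ** S = S ** D"
  shows "A *v column i S = D $ i $ i *s column i S"
proof -
  have "(A *v column i S) $ k = (A ** S) $ k $ i" for k
    by (simp add: matrix_vector_mult_def matrix_matrix_mult_def column_def)
  moreover have "(S ** D) $ k $ i = S $ k $ i * D $ i $ i" for k
  proof -
    have "(S ** D) $ k $ i = (\<Sum>j\<in>UNIV. if j = i then S $ k $ i * D $ i $ i else 0)"
      unfolding matrix_matrix_mult_def vec_lambda_beta by (intro sum.cong) (auto simp: assms(1))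
    thus ?thesis by simp
  qed
  ultimately show ?thesis by (simp add: vec_eq_iff column_def assms(2) mult.commute)
qed

text \<open>In the coordinates \<open>y\<close> of the diagonalizing basis the eigenvector equation
  decouples. As \<mu> occurs only once on the diagonal, \<open>y\<close> is supported at
  \<open>i\<close>. Thus an arbitrary diagonalizing basis still contains the given eigenvector up to
  scaling.\<close>

lemma simple_eigenvector_column:
  fixes A S D :: "'a::field^'n^'n"
  assumes S: "invertible S" and D: "\<And>i j. i \<noteq> j \<Longrightarrow> D $ i $ j = 0" and AS: "A ** S = S ** D"
    and simple: "order \<mu> (charpoly A) = 1" and v: "A *v v = \<mu> *s v" "v \<noteq> 0" and i: "D $ i $ i = \<mu>"
  shows "\<exists>c. column i S = c *s v"
proof -
  obtain S' where S': "S ** S' = mat 1" "S' ** S = mat 1"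
    using S by (auto simp: invertible_def)
  define y where "y = S' *v v"
  have vy: "v = S *v y" by (simp add: y_def matrix_vector_mul_assoc S')
  have "S *v (D *v y) = S *v (\<mu> *s y)"
    using v(1) by (simp add: vy matrix_vector_mul_assoc AS vector_scalar_commute)
  hence "S' *v (S *v (D *v y)) = S' *v (S *v (\<mu> *s y))" by simp
  hence Dy: "D *v y = \<mu> *s y" by (simp only: matrix_mul_assoc matrix_vector_mul_assoc S'
      matrix_mul_lid matrix_vector_mul_lid)
  have y0: "y $ j = 0" if "j \<noteq> i" for j
  proof -
    have "(D *v y) $ j = (\<Sum>k\<in>UNIV. if k = j then D $ j $ j * y $ j else 0)"
      unfolding matrix_vector_mult_def vec_lambda_beta by (intro sum.cong) (auto simp: D)
    hence "D $ j $ j * y $ j = (D *v y) $ j" by simp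
    hence "D $ j $ j * y $ j = \<mu> * y $ j" by (simp only: Dy vector_smult_component)
    hence "(D $ j $ j - \<mu>) * y $ j = 0" by (simp only: left_diff_distrib diff_self)
    moreover have "D $ j $ j \<noteq> \<mu>"
      using simple_root_unique_index[of \<mu> "\<lambda>k. D $ k $ k" i j] simple i that
      by (auto simp: charpoly_diagonalization[OF S D AS])
    ultimately show ?thesis by simp
  qed
  have vi: "v = y $ i *s column i S"
  proof -
    have "v $ k = (\<Sum>j\<in>UNIV. if j = i then S $ k $ i * y $ i else 0)" for k
      unfolding vy matrix_vector_mult_def vec_lambda_beta by (intro sum.cong) (auto simp: y0)
    thus ?thesis by (simp add: vec_eq_iff column_def mult.commute)
  qed
  hence "y $ i \<noteq> 0" using v(2) by auto
  hence "column i S = (1 / y $ i) *s v" by (subst vi) (simp add: vec_eq_iff)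
  thus ?thesis ..
qed

text \<open>Biorthogonality: \<open>tdot w (M *v s)\<close> is evaluated by letting \<open>M\<close>
  act to the left and to the right.\<close>

lemma tdot_eigenvectors:
  assumes "w v* M = \<nu> *s w" "M *v s = \<mu> *s s" "\<nu> \<noteq> \<mu>"
  shows "tdot w s = 0"
proof -
  have "tdot (w v* M) s = tdot w (M *v s)"
    unfolding tdot_def vector_matrix_mult_def matrix_vector_mult_def vec_lambda_beta
      sum_distrib_left sum_distrib_right
    by (subst sum.swap) (simp add: mult_ac)
  hence "(\<nu> - \<mu>) * tdot w s = 0"
    by (simp only: assms(1,2) left_diff_distrib) (simp add: tdot_def sum_distrib_left mult_ac)
  thus ?thesis using assms(3) by simp
qed

text \<open>The eigenvector equation is read in the component where \<open>s\<close> has its largest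
  modulus. This crude bound keeps the roots in a bounded set as soon as \<open>M\<close> is
  bounded.\<close>

lemma norm_eigenvalue_le:
  fixes M :: "complex^'n^'n"
  assumes "M *v s = \<mu> *s s" "s \<noteq> 0"
  shows "norm \<mu> \<le> real CARD('n) * norm M"
proof -
  obtain i where i: "\<And>j. norm (s $ j) \<le> norm (s $ i)"
  proof -
    have "finite (range (\<lambda>j. norm (s $ j)))" by simp
    hence "Max (range (\<lambda>j. norm (s $ j))) \<in> range (\<lambda>j. norm (s $ j))" by (intro Max_in) auto
    then obtain i where "norm (s $ i) = Max (range (\<lambda>j. norm (s $ j)))" by force
    thus thesis by (intro that[of i]) simp
  qed
  have pos: "norm (s $ i) > 0"
  proof (rule ccontr)
    assume "\<not> ?thesis"
    with i have "s $ j = 0" for j by (metis norm_le_zero_iff not_le order_trans)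
    thus False using assms(2) by (simp add: vec_eq_iff)
  qed
  have "norm \<mu> * norm (s $ i) = norm ((M *v s) $ i)" by (simp add: assms(1) norm_mult)
  also have "\<dots> \<le> (\<Sum>j\<in>(UNIV :: 'n set). norm M * norm (s $ i))"
    unfolding matrix_vector_mult_def vec_lambda_beta
  proof (rule sum_norm_le)
    fix j :: 'n
    have "norm (M $ i $ j) \<le> norm M"
      by (rule order_trans[OF Finite_Cartesian_Product.norm_nth_le Finite_Cartesian_Product.norm_nth_le])
    thus "norm (M $ i $ j * s $ j) \<le> norm M * norm (s $ i)"
      unfolding norm_mult using i by (intro mult_mono) auto
  qed
  finally show ?thesis using pos by simp
qed

text \<open>It suffices to test on the columns of a diagonalizing matrix. Those for the two simple
  eigenvalues are multiples of \<open>v1\<close> or \<open>v2\<close> and are killed by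
  \<open>R\<close>. The others are biorthogonal to \<open>w1\<close> and \<open>w2\<close>, hence
  fixed by \<open>R\<close>, and are killed by the factor for their own eigenvalue.\<close>

lemma spectral_complement_annihilator:
  fixes M R :: "complex^'n^'n"
  assumes "diagonalizable M" and "0 < \<delta>"
    and "order \<nu>1 (charpoly M) = 1" "M *v v1 = \<nu>1 *s v1" "v1 \<noteq> 0" "w1 v* M = \<nu>1 *s w1"
    and "order \<nu>2 (charpoly M) = 1" "M *v v2 = \<nu>2 *s v2" "v2 \<noteq> 0" "w2 v* M = \<nu>2 *s w2"
    and gap: "\<And>\<mu>. eigenvalue M \<mu> \<Longrightarrow> \<mu> \<noteq> \<nu>1 \<Longrightarrow> \<mu> \<noteq> \<nu>2 \<Longrightarrow> \<delta> \<le> Re \<mu>"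
    and R: "R *v v1 = 0" "R *v v2 = 0" "\<And>s. tdot w1 s = 0 \<Longrightarrow> tdot w2 s = 0 \<Longrightarrow> R *v s = s"
  obtains d :: "complex^'n" where "norm d \<le> real CARD('n) * (\<delta> + real CARD('n) * norm M)"
    "\<forall>i. \<delta> \<le> Re (d $ i)" "\<And>js. set js = UNIV \<Longrightarrow> root_matrix M (map (($) d) js) ** R = 0"
proof -
  obtain S D :: "complex^'n^'n" where SD: "invertible S" "\<And>i j. i \<noteq> j \<Longrightarrow> D $ i $ j = 0" "M ** S = S ** D"
    using assms(1) unfolding diagonalizable_def by blast
  obtain S' where S': "S ** S' = mat 1" "S' ** S = mat 1"
    using SD(1) by (auto simp: invertible_def)
  note col = diagonalization_column[OF SD(2,3)]
  have col_nz: "column i S \<noteq> 0" for i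
  proof
    assume "column i S = 0"
    hence "S' *v column i S = 0" by simp
    moreover have "(S' *v column i S) $ i = (S' ** S) $ i $ i"
      by (simp add: matrix_vector_mult_def matrix_matrix_mult_def column_def)
    ultimately show False by (simp add: S' mat_def)
  qed
  \<comment> \<open>The diagonal entries serve as roots, with the two exceptional eigenvalues
    replaced by the dummy root \<delta>. The number of roots is then always the dimension, and each
    has real part at least \<delta>.\<close>
  define d :: "complex^'n"
    where "d = (\<chi> i. if D $ i $ i = \<nu>1 \<or> D $ i $ i = \<nu>2 then of_real \<delta> else D $ i $ i)"
  show thesis
  proof (rule that[of d])
    have "norm (d $ i) \<le> \<delta> + real CARD('n) * norm M" for i
      using norm_eigenvalue_le[OF col col_nz, of i] assms(2) by (simp add: d_def add_increasing)
    hence "(\<Sum>i\<in>UNIV. norm (d $ i)) \<le> of_nat CARD('n) * (\<delta> + real CARD('n) * norm M)"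
      by (intro sum_bounded_above)
    moreover have "norm d \<le> (\<Sum>i\<in>UNIV. norm (d $ i))"
      unfolding norm_vec_def by (rule L2_set_le_sum) simp
    ultimately show "norm d \<le> real CARD('n) * (\<delta> + real CARD('n) * norm M)" by simp
    show "\<forall>i. \<delta> \<le> Re (d $ i)"
      using gap col col_nz by (auto simp: d_def eigenvalue_def right_eigenvector_def)
  next
    fix js :: "'n list" assume js: "set js = UNIV"
    let ?P = "root_matrix M (map (($) d) js)"
    have "?P *v (R *v column i S) = 0" for i
    proof (cases "D $ i $ i = \<nu>1 \<or> D $ i $ i = \<nu>2")
      case True
      then obtain c v where "column i S = c *s v" "R *v v = 0"
        using simple_eigenvector_column[OF SD assms(3-5)] simple_eigenvector_column[OF SD assms(7-9)] R
        by metis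
      hence "R *v column i S = 0" by (simp only: vector_scalar_commute) simp
      thus ?thesis by simp
    next
      case False
      have "R *v column i S = column i S"
        using False by (intro R(3) tdot_eigenvectors[OF assms(6) col] tdot_eigenvectors[OF assms(10) col]) auto
      moreover have "(\<Prod>e\<leftarrow>map (($) d) js. D $ i $ i - e) = 0"
        using False js by (simp add: prod_list_zero_iff d_def image_iff) (metis UNIV_I)
      ultimately show ?thesis
        by (simp add: root_matrix_eigenvector[OF col])
    qed
    hence "((?P ** R) ** S) $ k $ i = 0" for k i
      by (simp add: matrix_vector_mul_assoc vec_eq_iff)
        (simp add: matrix_vector_mult_def matrix_matrix_mult_def column_def)
    hence "(?P ** R) ** S = 0" by (simp add: vec_eq_iff)
    hence "((?P ** R) ** S) ** S' = 0" by simp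
    thus "?P ** R = 0" by (simp add: S' flip: matrix_mul_assoc)
  qed
qed

section \<open>The covariance near the Hopf point\<close>

lemma cmat_mult: "cmat (A ** B) = cmat A ** cmat B"
  by (simp add: cmat_def vec_eq_iff matrix_matrix_mult_def)

lemma cmat_transpose: "cmat (transpose A) = transpose (cmat A)"
  by (simp add: cmat_def vec_eq_iff transpose_def)

lemma cmat_add: "cmat (A + B) = cmat A + cmat B"
  by (simp add: cmat_def vec_eq_iff)

lemma norm_cmat: "norm (cmat A) = norm A"
  by (simp add: norm_vec_def cmat_def)

lemma Re_vec_cmat_mult: "Re_vec (cmat A *v v) = A *v Re_vec v"
  and Im_vec_cmat_mult: "Im_vec (cmat A *v v) = A *v Im_vec v"
  by (simp_all add: vec_eq_iff Re_vec_def Im_vec_def cmat_def matrix_vector_mult_def)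

lemma Re_vec_mult_cmat: "Re_vec (v v* cmat A) = Re_vec v v* A"
  and Im_vec_mult_cmat: "Im_vec (v v* cmat A) = Im_vec v v* A"
  by (simp_all add: vec_eq_iff Re_vec_def Im_vec_def cmat_def vector_matrix_mult_def)

lemma Re_vec_scale: "Re_vec (c *s v) = Re c *\<^sub>R Re_vec v - Im c *\<^sub>R Im_vec v"
  and Im_vec_scale: "Im_vec (c *s v) = Im c *\<^sub>R Re_vec v + Re c *\<^sub>R Im_vec v"
  by (simp_all add: vec_eq_iff Re_vec_def Im_vec_def algebra_simps)

lemma norm_complex_vec_sq: "(norm v)\<^sup>2 = (norm (Re_vec v))\<^sup>2 + (norm (Im_vec v))\<^sup>2"
  by (simp add: norm_vec_def L2_set_def sum_nonneg Re_vec_def Im_vec_def cmod_power2 sum.distrib)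

lemma Re_tdot: "Re (tdot w v) = Re_vec w \<bullet> Re_vec v - Im_vec w \<bullet> Im_vec v"
  and Im_tdot: "Im (tdot w v) = Re_vec w \<bullet> Im_vec v + Im_vec w \<bullet> Re_vec v"
  by (simp_all add: tdot_def Re_vec_def Im_vec_def inner_vec_def sum_subtractf sum.distrib)

lemma Re_vec_cnj: "Re_vec (cnj_vec v) = Re_vec v"
  and Im_vec_cnj: "Im_vec (cnj_vec v) = - Im_vec v"
  by (simp_all add: vec_eq_iff Re_vec_def Im_vec_def cnj_vec_def)

lemma psd_cauchy_schwarz:
  fixes C :: "real^'n^'n"
  assumes "transpose C = C" and psd: "\<And>a. 0 \<le> a \<bullet> (C *v a)"
  shows "(x \<bullet> (C *v y))\<^sup>2 \<le> (x \<bullet> (C *v x)) * (y \<bullet> (C *v y))"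
proof -
  have sym: "y \<bullet> (C *v x) = x \<bullet> (C *v y)"
    by (rule inner_matrix_vector_commute[OF assms(1)])
  have quad: "0 \<le> x \<bullet> (C *v x) + 2 * t * (x \<bullet> (C *v y)) + t\<^sup>2 * (y \<bullet> (C *v y))" for t
    using psd[of "x + t *\<^sub>R y"]
    by (simp add: matrix_vector_right_distrib matrix_vector_mult_scaleR inner_add_left inner_add_right sym
        power2_eq_square algebra_simps)
  show ?thesis
  proof (cases "y \<bullet> (C *v y) = 0")
    case True
    have "x \<bullet> (C *v y) = 0"
    proof (rule ccontr)
      assume nz: "x \<bullet> (C *v y) \<noteq> 0"
      \<comment> \<open>For \<open>y\<close> in the kernel of the form the quadratic is affine in
        \<open>t\<close>; this \<open>t\<close> gives it the value -1.\<close>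
      from quad[of "- (x \<bullet> (C *v x) + 1) / (2 * (x \<bullet> (C *v y)))"] True nz show False
        by (simp add: field_simps)
    qed
    thus ?thesis using True by simp
  next
    case False
    hence pos: "0 < y \<bullet> (C *v y)" using psd[of y] by simp
    have "0 \<le> (x \<bullet> (C *v x)) - (x \<bullet> (C *v y))\<^sup>2 / (y \<bullet> (C *v y))"
      \<comment> \<open>The minimizer of the quadratic in \<open>t\<close>.\<close>
      using quad[of "- (x \<bullet> (C *v y)) / (y \<bullet> (C *v y))"] pos
      by (simp add: power2_eq_square field_simps)
    thus ?thesis using pos by (simp add: field_simps)
  qed
qed

text \<open>This is I - 2 Re(v w^T), that is, I minus v w^T and its conjugate. Under the
  biorthogonal normalization it is the real spectral projection along the Hopf plane.\<close>

definition hopf_complement :: "complex^'n \<Rightarrow> complex^'n \<Rightarrow> real^'n^'n" where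
  "hopf_complement v w = mat 1 -
     (\<chi> i j. 2 * (Re_vec v $ i * Re_vec w $ j - Im_vec v $ i * Im_vec w $ j))"

text \<open>The Hopf pair assumption at a single parameter value, which separates the algebra from
  the passage to the limit.\<close>

locale hopf_pair =
  fixes M :: "real^'n^'n" and \<eta> \<Omega> \<delta> :: real and v w :: "complex^'n"
  assumes delta_pos: "0 < \<delta>"
    and diag: "diagonalizable (cmat M)"
    and simple: "simple_eigenvalue (cmat M) (Complex \<eta> \<Omega>)" "simple_eigenvalue (cmat M) (Complex \<eta> (- \<Omega>))"
    and gap: "\<And>\<mu>. eigenvalue (cmat M) \<mu> \<Longrightarrow> \<mu> \<noteq> Complex \<eta> \<Omega> \<Longrightarrow> \<mu> \<noteq> Complex \<eta> (- \<Omega>) \<Longrightarrow> \<delta> \<le> Re \<mu>"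
    and right: "right_eigenvector (cmat M) (Complex \<eta> \<Omega>) v"
      "right_eigenvector (cmat M) (Complex \<eta> (- \<Omega>)) (cnj_vec v)"
    and left: "left_eigenvector (cmat M) (Complex \<eta> \<Omega>) w"
      "left_eigenvector (cmat M) (Complex \<eta> (- \<Omega>)) (cnj_vec w)"
    and normalized: "tdot w v = 1" "tdot w (cnj_vec v) = 0"
begin

abbreviation "p \<equiv> Re_vec v"
abbreviation "q \<equiv> Im_vec v"
abbreviation "r \<equiv> Re_vec w"
abbreviation "t \<equiv> Im_vec w"
abbreviation "R \<equiv> hopf_complement v w"

lemma right_real: "M *v p = \<eta> *\<^sub>R p - \<Omega> *\<^sub>R q" "M *v q = \<Omega> *\<^sub>R p + \<eta> *\<^sub>R q"
proof -
  have "cmat M *v v = Complex \<eta> \<Omega> *s v" using right(1) by (simp add: right_eigenvector_def)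
  from arg_cong[OF this, of Re_vec] arg_cong[OF this, of Im_vec]
  show "M *v p = \<eta> *\<^sub>R p - \<Omega> *\<^sub>R q" "M *v q = \<Omega> *\<^sub>R p + \<eta> *\<^sub>R q"
    by (simp_all add: Re_vec_cmat_mult Im_vec_cmat_mult Re_vec_scale Im_vec_scale)
qed

lemma left_real: "r v* M = \<eta> *\<^sub>R r - \<Omega> *\<^sub>R t" "t v* M = \<Omega> *\<^sub>R r + \<eta> *\<^sub>R t"
proof -
  have "w v* cmat M = Complex \<eta> \<Omega> *s w" using left(1) by (simp add: left_eigenvector_def)
  from arg_cong[OF this, of Re_vec] arg_cong[OF this, of Im_vec]
  show "r v* M = \<eta> *\<^sub>R r - \<Omega> *\<^sub>R t" "t v* M = \<Omega> *\<^sub>R r + \<eta> *\<^sub>R t"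
    by (simp_all add: Re_vec_mult_cmat Im_vec_mult_cmat Re_vec_scale Im_vec_scale)
qed

text \<open>Real and imaginary parts of the two normalizations are four linear equations for these
  products. The halves account for the factor 2 in \<open>hopf_complement\<close>.\<close>

lemma biorthogonal: "r \<bullet> p = 1 / 2" "t \<bullet> q = - 1 / 2" "r \<bullet> q = 0" "t \<bullet> p = 0"
  using arg_cong[OF normalized(1), of Re] arg_cong[OF normalized(1), of Im]
    arg_cong[OF normalized(2), of Re] arg_cong[OF normalized(2), of Im]
  by (simp_all add: Re_tdot Im_tdot Re_vec_cnj Im_vec_cnj)

lemma complement_mult: "R *v x = x - 2 *\<^sub>R ((r \<bullet> x) *\<^sub>R p - (t \<bullet> x) *\<^sub>R q)"
  unfolding hopf_complement_def matrix_vector_mult_diff_rdistrib matrix_vector_mul_lid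
  by (simp add: vec_eq_iff matrix_vector_mult_def inner_vec_def sum_distrib_left sum_distrib_right
      sum_subtractf algebra_simps)

lemma mult_complement: "x v* R = x - 2 *\<^sub>R ((p \<bullet> x) *\<^sub>R r - (q \<bullet> x) *\<^sub>R t)"
  unfolding hopf_complement_def vector_matrix_mult_diff_rdistrib vector_matrix_mul_rid
  by (simp add: vec_eq_iff vector_matrix_mult_def inner_vec_def sum_distrib_left sum_distrib_right
      sum_subtractf algebra_simps)

text \<open>\<open>M\<close> multiplies v w^T by the same eigenvalue from either side. In real form,
  the blocks by which \<open>M\<close> acts on \<open>p\<close>, \<open>q\<close> and on
  \<open>r\<close>, \<open>t\<close> match.\<close>

lemma complement_commute: "M ** R = R ** M"
proof -
  have "(M ** R) *v x = (R ** M) *v x" for x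
  proof -
    have rt: "r \<bullet> (M *v x) = \<eta> * (r \<bullet> x) - \<Omega> * (t \<bullet> x)"
      "t \<bullet> (M *v x) = \<Omega> * (r \<bullet> x) + \<eta> * (t \<bullet> x)"
      unfolding dot_lmul_matrix[symmetric] left_real by (simp_all add: inner_diff_left inner_add_left)
    show ?thesis
      by (simp add: complement_mult right_real rt
          matrix_vector_mult_diff_distrib matrix_vector_right_distrib matrix_vector_mult_scaleR
          vec_eq_iff algebra_simps flip: matrix_vector_mul_assoc)
  qed
  thus ?thesis by (simp add: matrix_eq)
qed

lemma cmat_complement_mult:
  "cmat R *v s = s - (tdot w s *s v + tdot (cnj_vec w) s *s cnj_vec v)"
proof -
  have "(cmat R *v s) $ k = s $ k - (tdot w s * v $ k + tdot (cnj_vec w) s * cnj (v $ k))" for k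
  proof -
    have *: "complex_of_real (R $ k $ j) = (if k = j then 1 else 0) - (v $ k * w $ j + cnj (v $ k) * cnj (w $ j))" for j
      by (simp add: hopf_complement_def mat_def Re_vec_def Im_vec_def complex_eq_iff)
    hence "(cmat R *v s) $ k
        = (\<Sum>j\<in>UNIV. (if k = j then s $ j else 0) - (v $ k * w $ j + cnj (v $ k) * cnj (w $ j)) * s $ j)"
      unfolding matrix_vector_mult_def vec_lambda_beta
      by (intro sum.cong) (auto simp: cmat_def * left_diff_distrib)
    thus ?thesis
      by (simp add: sum_subtractf tdot_def cnj_vec_def sum_distrib_left sum.distrib algebra_simps)
  qed
  thus ?thesis by (simp add: vec_eq_iff cnj_vec_def)
qed

lemma cmat_complement_eigenvectors: "cmat R *v v = 0" "cmat R *v cnj_vec v = 0"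
proof -
  have "Re_vec (cmat R *v x) = 0 \<and> Im_vec (cmat R *v x) = 0" if "x = v \<or> x = cnj_vec v" for x
    using that
    by (auto simp: Re_vec_cmat_mult Im_vec_cmat_mult Re_vec_cnj Im_vec_cnj complement_mult biorthogonal)
  thus "cmat R *v v = 0" "cmat R *v cnj_vec v = 0"
    by (simp_all add: vec_eq_iff Re_vec_def Im_vec_def complex_eq_iff)
qed

text \<open>Since \<open>R\<close> commutes with \<open>M\<close>, the congruence by
  \<open>R\<close> passes through the Lyapunov operator.\<close>

lemma lyapunov_complement:
  assumes "M ** C + C ** transpose M = A"
  shows "M ** (R ** C ** transpose R) + (R ** C ** transpose R) ** transpose M = R ** A ** transpose R"
proof -
  have "transpose R ** transpose M = transpose M ** transpose R"
    by (simp add: complement_commute flip: matrix_transpose_mul)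
  moreover have "M ** (R ** C ** transpose R) = R ** (M ** C) ** transpose R"
    by (simp add: matrix_mul_assoc complement_commute)
  ultimately have "M ** (R ** C ** transpose R) + (R ** C ** transpose R) ** transpose M
      = R ** (M ** C) ** transpose R + R ** (C ** transpose M) ** transpose R"
    by (simp flip: matrix_mul_assoc)
  also have "\<dots> = R ** (M ** C + C ** transpose M) ** transpose R"
    by (simp add: matrix_add_ldistrib matrix_add_rdistrib)
  finally show ?thesis by (simp add: assms)
qed

lemma complement_annihilator:
  obtains d :: "complex^'n" where "norm d \<le> real CARD('n) * (\<delta> + real CARD('n) * norm M)"
    "\<forall>i. \<delta> \<le> Re (d $ i)" "\<And>js. set js = UNIV \<Longrightarrow> root_matrix (cmat M) (map (($) d) js) ** cmat R = 0"
proof (rule spectral_complement_annihilator[OF diag delta_pos,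
      of "Complex \<eta> \<Omega>" v w "Complex \<eta> (- \<Omega>)" "cnj_vec v" "cnj_vec w" "cmat R"])
  show "cmat R *v s = s" if "tdot w s = 0" "tdot (cnj_vec w) s = 0" for s
    using that by (simp add: cmat_complement_mult)
qed (use simple right left gap cmat_complement_eigenvectors that in
    \<open>auto simp: simple_eigenvalue_def right_eigenvector_def left_eigenvector_def norm_cmat\<close>)

text \<open>Testing the Lyapunov equation with the pairs from \<open>r\<close>, \<open>t\<close>
  gives a closed system of three linear equations for the covariance on the Hopf plane. Damping
  alone governs the sum of the two variances. Rotation mixes their difference with the covariance,
  and the denominator \<eta>^2 + \<Omega>^2 keeps these two bounded, so that they vanish after
  scaling by \<eta>: the limit is isotropic.\<close>

lemma hopf_plane_covariance:
  assumes C: "transpose C = C" and lyap: "M ** C + C ** transpose M = B ** transpose B" and "0 < \<eta>"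
  defines "\<beta> \<equiv> (norm (r v* B))\<^sup>2 - (norm (t v* B))\<^sup>2" and "\<kappa> \<equiv> (r v* B) \<bullet> (t v* B)"
  shows "\<eta> * (r \<bullet> (C *v r)) + \<eta> * (t \<bullet> (C *v t)) = (norm (cmat (transpose B) *v w))\<^sup>2 / 2"
    and "\<eta> * (r \<bullet> (C *v r)) - \<eta> * (t \<bullet> (C *v t)) = \<eta> * (\<eta> * \<beta> / 2 + \<Omega> * \<kappa>) / (\<eta>\<^sup>2 + \<Omega>\<^sup>2)"
    and "\<eta> * (r \<bullet> (C *v t)) = \<eta> * (\<eta> * \<kappa> - \<Omega> * \<beta> / 2) / (2 * (\<eta>\<^sup>2 + \<Omega>\<^sup>2))"
proof -
  have sym: "a \<bullet> (C *v b) = b \<bullet> (C *v a)" for a b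
    by (rule inner_matrix_vector_commute[OF C])
  \<comment> \<open>The Lyapunov equation as an identity of bilinear forms, with \<open>M\<close>
    moved onto the left vectors.\<close>
  have form: "(a v* M) \<bullet> (C *v b) + (b v* M) \<bullet> (C *v a) = (a v* B) \<bullet> (b v* B)" for a b
  proof -
    have "a \<bullet> ((M ** C + C ** transpose M) *v b) = a \<bullet> ((B ** transpose B) *v b)"
      by (simp add: lyap)
    moreover have "a \<bullet> ((M ** C) *v b) = (a v* M) \<bullet> (C *v b)"
      by (simp add: dot_lmul_matrix flip: matrix_vector_mul_assoc)
    moreover have "a \<bullet> ((C ** transpose M) *v b) = (b v* M) \<bullet> (C *v a)"
      by (simp add: sym[of a] flip: matrix_vector_mul_assoc)
    moreover have "a \<bullet> ((B ** transpose B) *v b) = (a v* B) \<bullet> (b v* B)"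
      by (simp add: dot_lmul_matrix flip: matrix_vector_mul_assoc)
    ultimately show ?thesis by (simp add: matrix_vector_mult_add_rdistrib inner_add_right)
  qed
  define x y c where "x = r \<bullet> (C *v r)" and "y = t \<bullet> (C *v t)" and "c = r \<bullet> (C *v t)"
  have 1: "2 * (\<eta> * x - \<Omega> * c) = (norm (r v* B))\<^sup>2"
    using form[of r r] by (simp add: left_real inner_diff_left sym[of t r] power2_norm_eq_inner x_def c_def)
  have 2: "2 * (\<eta> * y + \<Omega> * c) = (norm (t v* B))\<^sup>2"
    using form[of t t] by (simp add: left_real inner_add_left power2_norm_eq_inner y_def c_def)
  have 3: "2 * \<eta> * c + \<Omega> * (x - y) = \<kappa>"
    using form[of r t] by (simp add: left_real inner_diff_left inner_add_left sym[of t r] x_def y_def c_def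
        \<kappa>_def algebra_simps)
  have "(norm (cmat (transpose B) *v w))\<^sup>2 = (norm (r v* B))\<^sup>2 + (norm (t v* B))\<^sup>2"
    by (simp add: norm_complex_vec_sq Re_vec_cmat_mult Im_vec_cmat_mult)
  thus "\<eta> * x + \<eta> * y = (norm (cmat (transpose B) *v w))\<^sup>2 / 2"
    using 1 2 by (simp add: algebra_simps)
  have \<beta>: "\<beta> = 2 * (\<eta> * (x - y) - 2 * \<Omega> * c)"
    using 1 2 by (simp add: \<beta>_def algebra_simps)
  have pos: "0 < \<eta>\<^sup>2 + \<Omega>\<^sup>2" using \<open>0 < \<eta>\<close> by (simp add: add_pos_nonneg)
  have "\<eta> * \<beta> / 2 + \<Omega> * \<kappa> = (x - y) * (\<eta>\<^sup>2 + \<Omega>\<^sup>2)"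
    unfolding 3[symmetric] \<beta> by (simp add: power2_eq_square field_simps)
  hence "x - y = (\<eta> * \<beta> / 2 + \<Omega> * \<kappa>) / (\<eta>\<^sup>2 + \<Omega>\<^sup>2)" using pos by (simp add: field_simps)
  thus "\<eta> * x - \<eta> * y = \<eta> * (\<eta> * \<beta> / 2 + \<Omega> * \<kappa>) / (\<eta>\<^sup>2 + \<Omega>\<^sup>2)"
    by (metis right_diff_distrib times_divide_eq_right)
  have "\<eta> * \<kappa> - \<Omega> * \<beta> / 2 = c * (2 * (\<eta>\<^sup>2 + \<Omega>\<^sup>2))"
    unfolding 3[symmetric] \<beta> by (simp add: power2_eq_square field_simps)
  hence "c = (\<eta> * \<kappa> - \<Omega> * \<beta> / 2) / (2 * (\<eta>\<^sup>2 + \<Omega>\<^sup>2))" using pos by (simp add: field_simps)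
  thus "\<eta> * c = \<eta> * (\<eta> * \<kappa> - \<Omega> * \<beta> / 2) / (2 * (\<eta>\<^sup>2 + \<Omega>\<^sup>2))"
    by (metis times_divide_eq_right)
qed

end

text \<open>The complex uniform bound is applied to the complexification of
  \<open>R ** C ** transpose R\<close>, so the constant depends only on the dimension, on \<delta>
  and on the bound \<open>m\<close>.\<close>

lemma hopf_complement_covariance_bound:
  assumes "0 < \<delta>"
  obtains c where "\<And>(M :: real^'n^'n) \<eta> \<Omega> v w C A. hopf_pair M \<eta> \<Omega> \<delta> v w \<Longrightarrow> norm M \<le> m \<Longrightarrow>
      transpose C = C \<Longrightarrow> M ** C + C ** transpose M = A \<Longrightarrow>
      norm (hopf_complement v w ** C ** transpose (hopf_complement v w))
        \<le> c * norm (hopf_complement v w ** A ** transpose (hopf_complement v w))"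
proof -
  \<comment> \<open>One radius for both the matrix and the vector of roots; the second entry is the
    bound on the roots from \<open>complement_annihilator\<close>.\<close>
  let ?m = "max m (real CARD('n) * (\<delta> + real CARD('n) * m))"
  obtain js :: "'n list" where js: "set js = UNIV" using finite_list[OF finite] by blast
  obtain c where c: "\<And>(M :: complex^'n^'n) d X. \<lbrakk>norm M \<le> ?m; norm d \<le> ?m; \<forall>i. \<delta> \<le> Re (d $ i);
      root_matrix M (map (($) d) js) ** X = 0;
      X ** transpose (root_matrix M (map (($) d) js)) = 0\<rbrakk>
    \<Longrightarrow> norm X \<le> c * norm (M ** X + X ** transpose M)"
    using lyapunov_uniform_bound[OF assms, of ?m js] by metis
  show thesis
  proof (rule that[of c])
    fix M :: "real^'n^'n" and \<eta> \<Omega> v w C A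
    assume "hopf_pair M \<eta> \<Omega> \<delta> v w" and M: "norm M \<le> m" and C: "transpose C = C"
      and lyap: "M ** C + C ** transpose M = A"
    interpret hopf_pair M \<eta> \<Omega> \<delta> v w by fact
    obtain d :: "complex^'n" where d: "norm d \<le> real CARD('n) * (\<delta> + real CARD('n) * norm M)"
      "\<forall>i. \<delta> \<le> Re (d $ i)" "root_matrix (cmat M) (map (($) d) js) ** cmat R = 0"
      using complement_annihilator js by metis
    let ?P = "root_matrix (cmat M) (map (($) d) js)" and ?K = "R ** C ** transpose R"
    have "norm d \<le> real CARD('n) * (\<delta> + real CARD('n) * m)"
      using d(1) by (rule order_trans) (intro mult_left_mono add_left_mono M; simp)
    moreover have PK: "?P ** cmat ?K = 0"
      by (simp add: cmat_mult matrix_mul_assoc d(3))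
    \<comment> \<open>By symmetry of \<open>?K\<close> the right annihilation is the transpose of
      the left one.\<close>
    moreover have "cmat ?K ** transpose ?P = 0"
    proof -
      have "transpose ?K = ?K" by (simp add: matrix_transpose_mul C matrix_mul_assoc)
      hence "cmat ?K ** transpose ?P = transpose (?P ** cmat ?K)"
        by (simp add: matrix_transpose_mul flip: cmat_transpose)
      thus ?thesis using PK by (simp add: transpose_def vec_eq_iff)
    qed
    ultimately have "norm (cmat ?K) \<le> c * norm (cmat M ** cmat ?K + cmat ?K ** transpose (cmat M))"
      using M d(2) by (intro c[of _ d]) (auto simp: norm_cmat)
    also have "cmat M ** cmat ?K + cmat ?K ** transpose (cmat M) = cmat (R ** A ** transpose R)"
      unfolding lyapunov_complement[OF lyap, symmetric] by (simp only: cmat_add cmat_mult cmat_transpose)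
    finally show "norm ?K \<le> c * norm (R ** A ** transpose R)" by (simp only: norm_cmat)
  qed
qed

section \<open>Limits of matrix expressions and of the rescaled covariance\<close>

lemma tendsto_Re_vec [tendsto_intros]: "(v \<longlongrightarrow> vc) Fl \<Longrightarrow> ((\<lambda>x. Re_vec (v x)) \<longlongrightarrow> Re_vec vc) Fl"
  and tendsto_Im_vec [tendsto_intros]: "(v \<longlongrightarrow> vc) Fl \<Longrightarrow> ((\<lambda>x. Im_vec (v x)) \<longlongrightarrow> Im_vec vc) Fl"
  unfolding Re_vec_def Im_vec_def by (intro tendsto_intros; assumption)+

lemma tendsto_matrix_mult [tendsto_intros]:
  fixes f :: "'x \<Rightarrow> 'a::real_normed_algebra_1^'n^'m" and g :: "'x \<Rightarrow> 'a^'k^'n"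
  assumes "(f \<longlongrightarrow> A) Fl" "(g \<longlongrightarrow> B) Fl"
  shows "((\<lambda>x. f x ** g x) \<longlongrightarrow> A ** B) Fl"
  unfolding matrix_matrix_mult_def by (intro tendsto_intros assms)

lemma tendsto_matrix_vector_mult [tendsto_intros]:
  fixes f :: "'x \<Rightarrow> 'a::real_normed_algebra_1^'n^'m" and g :: "'x \<Rightarrow> 'a^'n"
  assumes "(f \<longlongrightarrow> A) Fl" "(g \<longlongrightarrow> b) Fl"
  shows "((\<lambda>x. f x *v g x) \<longlongrightarrow> A *v b) Fl"
  unfolding matrix_vector_mult_def by (intro tendsto_intros assms)

lemma tendsto_vector_matrix_mult [tendsto_intros]:
  fixes f :: "'x \<Rightarrow> 'a::{real_normed_algebra_1,comm_ring_1}^'n^'m" and g :: "'x \<Rightarrow> 'a^'m"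
  assumes "(f \<longlongrightarrow> A) Fl" "(g \<longlongrightarrow> b) Fl"
  shows "((\<lambda>x. g x v* f x) \<longlongrightarrow> b v* A) Fl"
  unfolding vector_matrix_mult_def by (intro tendsto_intros assms)

lemma tendsto_transpose [tendsto_intros]:
  fixes f :: "'x \<Rightarrow> 'a::real_normed_vector^'n^'m"
  assumes "(f \<longlongrightarrow> A) Fl"
  shows "((\<lambda>x. transpose (f x)) \<longlongrightarrow> transpose A) Fl"
  unfolding transpose_def by (intro tendsto_intros assms)

lemma tendsto_hopf_complement:
  assumes "(v \<longlongrightarrow> vc) Fl" "(w \<longlongrightarrow> wc) Fl"
  shows "((\<lambda>x. hopf_complement (v x) (w x)) \<longlongrightarrow> hopf_complement vc wc) Fl"
  unfolding hopf_complement_def by (intro tendsto_intros assms)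

text \<open>Splitting \<open>a\<close> by the spectral projection onto the Hopf plane, the plane part has the stated
  limit, the complementary part of the covariance stays bounded and is annihilated by \<open>\<eta> \<rightarrow> 0\<close>, and
  the cross term is controlled by Cauchy-Schwarz.\<close>

lemma rescaled_covariance_quadratic_tendsto:
  fixes M C :: "'x \<Rightarrow> real^'n^'n" and B :: "real^'m^'n"
  assumes delta: "0 < \<delta>"
    and hopf: "\<forall>\<^sub>F x in Fl. hopf_pair (M x) (\<eta> x) (\<Omega> x) \<delta> (v x) (w x)"
    and M_bound: "\<forall>\<^sub>F x in Fl. norm (M x) \<le> m"
    and lyap: "\<forall>\<^sub>F x in Fl. M x ** C x + C x ** transpose (M x) = B ** transpose B"
    and sym: "\<forall>\<^sub>F x in Fl. transpose (C x) = C x"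
    and psd: "\<forall>\<^sub>F x in Fl. \<forall>a. 0 \<le> a \<bullet> (C x *v a)"
    and eta_pos: "\<forall>\<^sub>F x in Fl. 0 < \<eta> x" and eta: "(\<eta> \<longlongrightarrow> 0) Fl"
    and Omega: "(\<Omega> \<longlongrightarrow> \<Omega>c) Fl" and Omega_c: "\<Omega>c \<noteq> 0"
    and v: "(v \<longlongrightarrow> vc) Fl" and w: "(w \<longlongrightarrow> wc) Fl"
    and sigma: "((\<lambda>x. (norm (cmat (transpose B) *v w x))\<^sup>2) \<longlongrightarrow> \<sigma>2) Fl"
  shows "((\<lambda>x. \<eta> x * (a \<bullet> (C x *v a))) \<longlongrightarrow> \<sigma>2 * ((Re_vec vc \<bullet> a)\<^sup>2 + (Im_vec vc \<bullet> a)\<^sup>2)) Fl"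
proof -
  define r t where "r = (\<lambda>x. Re_vec (w x))" and "t = (\<lambda>x. Im_vec (w x))"
  define pa qa where "pa = (\<lambda>x. Re_vec (v x) \<bullet> a)" and "qa = (\<lambda>x. Im_vec (v x) \<bullet> a)"
  define \<beta> \<kappa> where "\<beta> = (\<lambda>x. (norm (r x v* B))\<^sup>2 - (norm (t x v* B))\<^sup>2)"
    and "\<kappa> = (\<lambda>x. (r x v* B) \<bullet> (t x v* B))"
  note r_t_defs = r_def t_def
  have pa: "(pa \<longlongrightarrow> Re_vec vc \<bullet> a) Fl" and qa: "(qa \<longlongrightarrow> Im_vec vc \<bullet> a) Fl"
    unfolding pa_def qa_def by (intro tendsto_intros v)+
  obtain \<beta>c where \<beta>: "(\<beta> \<longlongrightarrow> \<beta>c) Fl"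
  proof
    show "(\<beta> \<longlongrightarrow> (norm (Re_vec wc v* B))\<^sup>2 - (norm (Im_vec wc v* B))\<^sup>2) Fl"
      unfolding \<beta>_def r_t_defs by (intro tendsto_intros w)
  qed
  obtain \<kappa>c where \<kappa>: "(\<kappa> \<longlongrightarrow> \<kappa>c) Fl"
  proof
    show "(\<kappa> \<longlongrightarrow> (Re_vec wc v* B) \<bullet> (Im_vec wc v* B)) Fl"
      unfolding \<kappa>_def r_t_defs by (intro tendsto_intros w)
  qed
  define X Y Z where "X = (\<lambda>x. \<eta> x * (r x \<bullet> (C x *v r x)))" and "Y = (\<lambda>x. \<eta> x * (t x \<bullet> (C x *v t x)))"
    and "Z = (\<lambda>x. \<eta> x * (r x \<bullet> (C x *v t x)))"
  have plane: "\<forall>\<^sub>F x in Fl. X x + Y x = (norm (cmat (transpose B) *v w x))\<^sup>2 / 2 \<and>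
      X x - Y x = \<eta> x * (\<eta> x * \<beta> x / 2 + \<Omega> x * \<kappa> x) / ((\<eta> x)\<^sup>2 + (\<Omega> x)\<^sup>2) \<and>
      Z x = \<eta> x * (\<eta> x * \<kappa> x - \<Omega> x * \<beta> x / 2) / (2 * ((\<eta> x)\<^sup>2 + (\<Omega> x)\<^sup>2))"
    using hopf sym lyap eta_pos
  proof eventually_elim
    case (elim x)
    then interpret hopf_pair "M x" "\<eta> x" "\<Omega> x" \<delta> "v x" "w x" by simp
    from hopf_plane_covariance[OF elim(2,3,4)] show ?case
      by (simp add: X_def Y_def Z_def \<beta>_def \<kappa>_def r_t_defs)
  qed
  have XpY: "((\<lambda>x. X x + Y x) \<longlongrightarrow> \<sigma>2 / 2) Fl"
  proof (rule Lim_transform_eventually)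
    show "((\<lambda>x. (norm (cmat (transpose B) *v w x))\<^sup>2 / 2) \<longlongrightarrow> \<sigma>2 / 2) Fl"
      by (intro tendsto_intros sigma) simp
  qed (use plane in eventually_elim, simp)
  \<comment> \<open>The denominator tends to the square of \<open>\<Omega>c\<close>, which is
    nonzero, and the factor \<eta> sends the quotient to zero.\<close>
  have XmY: "((\<lambda>x. X x - Y x) \<longlongrightarrow> 0) Fl"
  proof (rule Lim_transform_eventually)
    show "((\<lambda>x. \<eta> x * (\<eta> x * \<beta> x / 2 + \<Omega> x * \<kappa> x) / ((\<eta> x)\<^sup>2 + (\<Omega> x)\<^sup>2)) \<longlongrightarrow> 0) Fl"
      by (rule tendsto_eq_intros eta Omega \<beta> \<kappa> refl | use Omega_c in simp)+
  qed (use plane in eventually_elim, simp)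
  have Z: "(Z \<longlongrightarrow> 0) Fl"
  proof (rule Lim_transform_eventually)
    show "((\<lambda>x. \<eta> x * (\<eta> x * \<kappa> x - \<Omega> x * \<beta> x / 2) / (2 * ((\<eta> x)\<^sup>2 + (\<Omega> x)\<^sup>2))) \<longlongrightarrow> 0) Fl"
      by (rule tendsto_eq_intros eta Omega \<beta> \<kappa> refl | use Omega_c in simp)+
  qed (use plane in eventually_elim, simp)
  have X: "(X \<longlongrightarrow> \<sigma>2 / 4) Fl" and Y: "(Y \<longlongrightarrow> \<sigma>2 / 4) Fl"
    using tendsto_divide[OF tendsto_add[OF XpY XmY] tendsto_const, of 2]
      tendsto_divide[OF tendsto_diff[OF XpY XmY] tendsto_const, of 2] by simp_all
  \<comment> \<open>The part of \<open>a\<close> in the span of \<open>r x\<close> and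
    \<open>t x\<close>. Covariances are tested with left vectors, so the splitting uses the
    transposed projection.\<close>
  define y where "y = (\<lambda>x. 2 *\<^sub>R (pa x *\<^sub>R r x - qa x *\<^sub>R t x))"
  define u where "u = (\<lambda>x. a - y x)"
  have yy: "((\<lambda>x. \<eta> x * (y x \<bullet> (C x *v y x))) \<longlongrightarrow> \<sigma>2 * ((Re_vec vc \<bullet> a)\<^sup>2 + (Im_vec vc \<bullet> a)\<^sup>2)) Fl"
  proof (rule Lim_transform_eventually)
    show "((\<lambda>x. 4 * ((pa x)\<^sup>2 * X x - 2 * pa x * qa x * Z x + (qa x)\<^sup>2 * Y x))
        \<longlongrightarrow> \<sigma>2 * ((Re_vec vc \<bullet> a)\<^sup>2 + (Im_vec vc \<bullet> a)\<^sup>2)) Fl"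
      by (rule tendsto_eq_intros pa qa X Y Z refl | simp add: algebra_simps)+
    show "\<forall>\<^sub>F x in Fl. 4 * ((pa x)\<^sup>2 * X x - 2 * pa x * qa x * Z x + (qa x)\<^sup>2 * Y x)
        = \<eta> x * (y x \<bullet> (C x *v y x))"
      using sym
    proof eventually_elim
      case (elim x)
      have "t x \<bullet> (C x *v r x) = r x \<bullet> (C x *v t x)"
        by (rule inner_matrix_vector_commute[OF elim])
      thus ?case
        by (simp add: y_def X_def Y_def Z_def matrix_vector_mult_diff_distrib matrix_vector_mult_scaleR
            inner_diff_left inner_diff_right power2_eq_square algebra_simps)
    qed
  qed
  have uu: "((\<lambda>x. \<eta> x * (u x \<bullet> (C x *v u x))) \<longlongrightarrow> 0) Fl"
  proof -
    define R K where "R = (\<lambda>x. hopf_complement (v x) (w x))" and "K = (\<lambda>x. R x ** C x ** transpose (R x))"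
    obtain c where c: "\<And>(M :: real^'n^'n) \<eta> \<Omega> v w C A. hopf_pair M \<eta> \<Omega> \<delta> v w \<Longrightarrow> norm M \<le> m \<Longrightarrow>
      transpose C = C \<Longrightarrow> M ** C + C ** transpose M = A \<Longrightarrow>
      norm (hopf_complement v w ** C ** transpose (hopf_complement v w))
        \<le> c * norm (hopf_complement v w ** A ** transpose (hopf_complement v w))"
      using hopf_complement_covariance_bound[OF delta, of m] by metis
    have R: "(R \<longlongrightarrow> hopf_complement vc wc) Fl"
      unfolding R_def by (rule tendsto_hopf_complement[OF v w])
    have K: "((\<lambda>x. \<eta> x *\<^sub>R K x) \<longlongrightarrow> 0) Fl"
    proof (rule Lim_null_comparison)
      show "\<forall>\<^sub>F x in Fl. norm (\<eta> x *\<^sub>R K x) \<le> \<eta> x * (c * norm (R x ** (B ** transpose B) ** transpose (R x)))"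
        using hopf M_bound sym lyap eta_pos
      proof eventually_elim
        case (elim x)
        show ?case
          using c[OF elim(1-4)] elim(5) by (simp add: K_def R_def)
      qed
      show "((\<lambda>x. \<eta> x * (c * norm (R x ** (B ** transpose B) ** transpose (R x)))) \<longlongrightarrow> 0) Fl"
        by (rule tendsto_eq_intros tendsto_matrix_mult tendsto_transpose eta R refl | simp)+
    qed
    show ?thesis
    proof (rule Lim_transform_eventually)
      show "((\<lambda>x. a \<bullet> ((\<eta> x *\<^sub>R K x) *v a)) \<longlongrightarrow> 0) Fl"
        by (rule tendsto_eq_intros tendsto_matrix_vector_mult K refl | simp)+
      show "\<forall>\<^sub>F x in Fl. a \<bullet> ((\<eta> x *\<^sub>R K x) *v a) = \<eta> x * (u x \<bullet> (C x *v u x))"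
        using hopf
      proof eventually_elim
        case (elim x)
        then interpret hopf_pair "M x" "\<eta> x" "\<Omega> x" \<delta> "v x" "w x" .
        \<comment> \<open>Hence the form at \<open>u x\<close> is the form of \<open>K x\<close> at
          \<open>a\<close>, to which the uniform bound applies.\<close>
        have "u x = a v* R x"
          by (simp add: u_def y_def R_def mult_complement pa_def qa_def r_t_defs)
        thus ?case
          by (simp add: K_def dot_lmul_matrix flip: matrix_vector_mul_assoc scaleR_matrix_vector_assoc)
      qed
    qed
  qed
  have yu: "((\<lambda>x. \<eta> x * (y x \<bullet> (C x *v u x))) \<longlongrightarrow> 0) Fl"
  proof (rule Lim_null_comparison)
    show "\<forall>\<^sub>F x in Fl. norm (\<eta> x * (y x \<bullet> (C x *v u x)))
        \<le> sqrt (\<eta> x * (y x \<bullet> (C x *v y x)) * (\<eta> x * (u x \<bullet> (C x *v u x))))"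
      using sym psd eta_pos
    proof eventually_elim
      case (elim x)
      have "(\<eta> x * (y x \<bullet> (C x *v u x)))\<^sup>2
          \<le> (\<eta> x)\<^sup>2 * ((y x \<bullet> (C x *v y x)) * (u x \<bullet> (C x *v u x)))"
        unfolding power_mult_distrib using elim(2)
        by (intro mult_left_mono psd_cauchy_schwarz elim(1)) auto
      hence "(\<eta> x * (y x \<bullet> (C x *v u x)))\<^sup>2
          \<le> \<eta> x * (y x \<bullet> (C x *v y x)) * (\<eta> x * (u x \<bullet> (C x *v u x)))"
        by (simp add: power2_eq_square mult_ac)
      thus ?case unfolding real_norm_def by (rule real_le_rsqrt[OF order_trans[OF eq_refl[OF power2_abs]]])
    qed
    show "((\<lambda>x. sqrt (\<eta> x * (y x \<bullet> (C x *v y x)) * (\<eta> x * (u x \<bullet> (C x *v u x))))) \<longlongrightarrow> 0) Fl"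
      by (rule tendsto_eq_intros yy uu refl | simp)+
  qed
  show ?thesis
  proof (rule Lim_transform_eventually)
    show "((\<lambda>x. \<eta> x * (y x \<bullet> (C x *v y x)) + 2 * (\<eta> x * (y x \<bullet> (C x *v u x))) + \<eta> x * (u x \<bullet> (C x *v u x)))
        \<longlongrightarrow> \<sigma>2 * ((Re_vec vc \<bullet> a)\<^sup>2 + (Im_vec vc \<bullet> a)\<^sup>2)) Fl"
      by (rule tendsto_eq_intros yy yu uu refl | simp)+
    show "\<forall>\<^sub>F x in Fl. \<eta> x * (y x \<bullet> (C x *v y x)) + 2 * (\<eta> x * (y x \<bullet> (C x *v u x))) + \<eta> x * (u x \<bullet> (C x *v u x))
        = \<eta> x * (a \<bullet> (C x *v a))"
      using sym
    proof eventually_elim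
      case (elim x)
      have a: "a = y x + u x" by (simp add: u_def)
      have "u x \<bullet> (C x *v y x) = y x \<bullet> (C x *v u x)"
        by (rule inner_matrix_vector_commute[OF elim])
      thus ?case unfolding a
        by (simp add: matrix_vector_right_distrib inner_add_left inner_add_right algebra_simps)
    qed
  qed
qed

text \<open>Polarization: a symmetric form is a quarter of the difference of its quadratic form at a
  + b and a - b.\<close>

lemma rescaled_covariance_tendsto:
  fixes C :: "'x \<Rightarrow> real^'n^'n"
  assumes sym: "\<forall>\<^sub>F x in Fl. transpose (C x) = C x"
    and quad: "\<And>a. ((\<lambda>x. \<eta> x * (a \<bullet> (C x *v a))) \<longlongrightarrow> \<sigma>2 * ((p \<bullet> a)\<^sup>2 + (q \<bullet> a)\<^sup>2)) Fl"
  shows "((\<lambda>x. \<eta> x * (a \<bullet> (C x *v b))) \<longlongrightarrow> \<sigma>2 * ((p \<bullet> a) * (p \<bullet> b) + (q \<bullet> a) * (q \<bullet> b))) Fl"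
proof (rule Lim_transform_eventually)
  show "((\<lambda>x. (\<eta> x * ((a + b) \<bullet> (C x *v (a + b))) - \<eta> x * ((a - b) \<bullet> (C x *v (a - b)))) / 4)
      \<longlongrightarrow> \<sigma>2 * ((p \<bullet> a) * (p \<bullet> b) + (q \<bullet> a) * (q \<bullet> b))) Fl"
    by (rule tendsto_eq_intros quad refl
        | simp add: inner_add_right inner_diff_right power2_eq_square field_simps)+
  show "\<forall>\<^sub>F x in Fl. (\<eta> x * ((a + b) \<bullet> (C x *v (a + b))) - \<eta> x * ((a - b) \<bullet> (C x *v (a - b)))) / 4
      = \<eta> x * (a \<bullet> (C x *v b))"
    using sym
  proof eventually_elim
    case (elim x)
    have "b \<bullet> (C x *v a) = a \<bullet> (C x *v b)"
      by (rule inner_matrix_vector_commute[OF elim])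
    thus ?case
      by (simp add: matrix_vector_right_distrib matrix_vector_mult_diff_distrib inner_add_left
          inner_add_right inner_diff_left inner_diff_right field_simps)
  qed
qed

section \<open>Moments of quadratic forms of Gaussian vectors\<close>

lemma normal_law_moments:
  assumes "0 \<le> s"
  shows "has_bochner_integral (normal_law 0 s) (\<lambda>x. x) 0"
    and "has_bochner_integral (normal_law 0 s) (\<lambda>x. x\<^sup>2) s"
    and "has_bochner_integral (normal_law 0 s) (\<lambda>x. x ^ 3) 0"
    and "has_bochner_integral (normal_law 0 s) (\<lambda>x. x ^ 4) (3 * s\<^sup>2)"
proof -
  have "has_bochner_integral (normal_law 0 s) (\<lambda>x. x) 0 \<and>
    has_bochner_integral (normal_law 0 s) (\<lambda>x. x\<^sup>2) s \<and>
    has_bochner_integral (normal_law 0 s) (\<lambda>x. x ^ 3) 0 \<and>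
    has_bochner_integral (normal_law 0 s) (\<lambda>x. x ^ 4) (3 * s\<^sup>2)"
  proof (cases "s = 0")
    case True
    \<comment> \<open>A singular covariance may give a projection with zero variance. Its law is the
      point mass at 0, where every positive power vanishes almost everywhere.\<close>
    have "has_bochner_integral (return borel (0::real)) (\<lambda>x. x ^ k) 0" if "0 < k" for k :: nat
    proof -
      have "AE x in return borel (0::real). x ^ k = 0"
        using that by (subst AE_return) auto
      hence "has_bochner_integral (return borel (0::real)) (\<lambda>x. x ^ k) 0
          \<longleftrightarrow> has_bochner_integral (return borel (0::real)) (\<lambda>x. 0 :: real) 0"
        by (intro has_bochner_integral_cong_AE) auto
      thus ?thesis by (simp add: has_bochner_integral_zero)
    qed
    from this[of 1] this[of 2] this[of 3] this[of 4] True show ?thesis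
      by (simp add: normal_law_def)
  next
    case False
    with assms have s: "0 < sqrt s" by simp
    have *: "has_bochner_integral (normal_law 0 s) (\<lambda>x. x ^ k) r"
      if "has_bochner_integral lborel (\<lambda>x. normal_density 0 (sqrt s) x * (x - 0) ^ k) r" for k r
      using that False unfolding normal_law_def
      by (auto intro!: has_bochner_integral_density)
    \<comment> \<open>The even moment of order 2k has the form (2k)! / ((2/s)^k k!) with
      \<open>s\<close> the variance; here k = 2 and then k = 1.\<close>
    have "(fact (2 * 2) / ((2 / (sqrt s)\<^sup>2) ^ 2 * fact 2) :: real) = 3 * s\<^sup>2"
      using s assms by (simp add: fact_numeral power2_eq_square field_simps)
    moreover have "(fact (2 * 1) / ((2 / (sqrt s)\<^sup>2) ^ 1 * fact 1) :: real) = s"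
      using s assms by (simp add: fact_numeral)
    ultimately show ?thesis
      using *[OF normal_moment_odd[OF s, of 0 0]] *[OF normal_moment_even[OF s, of 0 1]]
        *[OF normal_moment_odd[OF s, of 0 1]] *[OF normal_moment_even[OF s, of 0 2]]
      by simp
  qed
  thus "has_bochner_integral (normal_law 0 s) (\<lambda>x. x) 0"
    and "has_bochner_integral (normal_law 0 s) (\<lambda>x. x\<^sup>2) s"
    and "has_bochner_integral (normal_law 0 s) (\<lambda>x. x ^ 3) 0"
    and "has_bochner_integral (normal_law 0 s) (\<lambda>x. x ^ 4) (3 * s\<^sup>2)"
    by auto
qed

lemma gaussian_vector_moments:
  fixes z :: "'a \<Rightarrow> real^'n"
  assumes "gaussian_vector Q z 0 C"
  shows "has_bochner_integral Q (\<lambda>\<omega>. a \<bullet> z \<omega>) 0"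
    and "has_bochner_integral Q (\<lambda>\<omega>. (a \<bullet> z \<omega>)\<^sup>2) (a \<bullet> (C *v a))"
    and "has_bochner_integral Q (\<lambda>\<omega>. (a \<bullet> z \<omega>) ^ 3) 0"
    and "has_bochner_integral Q (\<lambda>\<omega>. (a \<bullet> z \<omega>) ^ 4) (3 * (a \<bullet> (C *v a))\<^sup>2)"
proof -
  have [measurable]: "z \<in> borel_measurable Q" and pos: "0 \<le> a \<bullet> (C *v a)"
    and law: "distr Q borel (\<lambda>\<omega>. a \<bullet> z \<omega>) = normal_law 0 (a \<bullet> (C *v a))"
    using assms by (auto simp: gaussian_vector_def)
  have *: "has_bochner_integral Q (\<lambda>\<omega>. f (a \<bullet> z \<omega>)) r"
    if "has_bochner_integral (normal_law 0 (a \<bullet> (C *v a))) f r" and [measurable]: "f \<in> borel_measurable borel"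
    for f :: "real \<Rightarrow> real" and r
    using that(1) unfolding law[symmetric] has_bochner_integral_iff
    by (simp add: integrable_distr_eq integral_distr)
  show "has_bochner_integral Q (\<lambda>\<omega>. a \<bullet> z \<omega>) 0"
    and "has_bochner_integral Q (\<lambda>\<omega>. (a \<bullet> z \<omega>)\<^sup>2) (a \<bullet> (C *v a))"
    and "has_bochner_integral Q (\<lambda>\<omega>. (a \<bullet> z \<omega>) ^ 3) 0"
    and "has_bochner_integral Q (\<lambda>\<omega>. (a \<bullet> z \<omega>) ^ 4) (3 * (a \<bullet> (C *v a))\<^sup>2)"
    by (rule *[OF normal_law_moments(1)[OF pos]] *[OF normal_law_moments(2)[OF pos]]
        *[OF normal_law_moments(3)[OF pos]] *[OF normal_law_moments(4)[OF pos]]; simp)+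
qed

text \<open>Only one-dimensional projections are known to be Gaussian, so the mixed moments are obtained
  by polarization.\<close>

lemma gaussian_vector_mixed_moment_21:
  fixes z :: "'a \<Rightarrow> real^'n"
  assumes "gaussian_vector Q z 0 C"
  shows "has_bochner_integral Q (\<lambda>\<omega>. (a \<bullet> z \<omega>)\<^sup>2 * (b \<bullet> z \<omega>)) 0"
proof -
  note m3 = gaussian_vector_moments(3)[OF assms]
  have "has_bochner_integral Q
      (\<lambda>\<omega>. (((a + b) \<bullet> z \<omega>) ^ 3 - ((a - b) \<bullet> z \<omega>) ^ 3 - 2 * (b \<bullet> z \<omega>) ^ 3) * (1 / 6))
      ((0 - 0 - 2 * 0) * (1 / 6))"
    by (intro has_bochner_integral_mult_left has_bochner_integral_diff has_bochner_integral_mult_right m3)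
  moreover have "(((a + b) \<bullet> z \<omega>) ^ 3 - ((a - b) \<bullet> z \<omega>) ^ 3 - 2 * (b \<bullet> z \<omega>) ^ 3) * (1 / 6)
      = (a \<bullet> z \<omega>)\<^sup>2 * (b \<bullet> z \<omega>)" for \<omega>
    by (simp add: inner_add_left inner_diff_left power2_eq_square power3_eq_cube algebra_simps)
  ultimately show ?thesis by simp
qed

lemma gaussian_vector_mixed_moment_22:
  fixes z :: "'a \<Rightarrow> real^'n"
  assumes "gaussian_vector Q z 0 C"
  shows "has_bochner_integral Q (\<lambda>\<omega>. (a \<bullet> z \<omega>)\<^sup>2 * (b \<bullet> z \<omega>)\<^sup>2)
    ((a \<bullet> (C *v a)) * (b \<bullet> (C *v b)) + 2 * (a \<bullet> (C *v b))\<^sup>2)"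
proof -
  note m4 = gaussian_vector_moments(4)[OF assms]
  let ?q = "\<lambda>a. 3 * (a \<bullet> (C *v a))\<^sup>2"
  have C: "b \<bullet> (C *v a) = a \<bullet> (C *v b)"
    using assms by (intro inner_matrix_vector_commute) (simp add: gaussian_vector_def)
  \<comment> \<open>The sum of the fourth powers of a + b and a - b is 2 a^4 + 12 a^2 b^2 + 2 b^4,
    which explains the 12. The resulting value is Isserlis' formula.\<close>
  have "has_bochner_integral Q
      (\<lambda>\<omega>. (((a + b) \<bullet> z \<omega>) ^ 4 + ((a - b) \<bullet> z \<omega>) ^ 4 - 2 * (a \<bullet> z \<omega>) ^ 4 - 2 * (b \<bullet> z \<omega>) ^ 4) * (1 / 12))
      ((?q (a + b) + ?q (a - b) - 2 * ?q a - 2 * ?q b) * (1 / 12))"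
    by (intro has_bochner_integral_mult_left has_bochner_integral_diff has_bochner_integral_add
        has_bochner_integral_mult_right m4)
  moreover have "(((a + b) \<bullet> z \<omega>) ^ 4 + ((a - b) \<bullet> z \<omega>) ^ 4 - 2 * (a \<bullet> z \<omega>) ^ 4 - 2 * (b \<bullet> z \<omega>) ^ 4) * (1 / 12)
      = (a \<bullet> z \<omega>)\<^sup>2 * (b \<bullet> z \<omega>)\<^sup>2" for \<omega>
    by (simp add: inner_add_left inner_diff_left power4_eq_xxxx power2_eq_square algebra_simps)
  moreover have "(?q (a + b) + ?q (a - b) - 2 * ?q a - 2 * ?q b) * (1 / 12)
      = (a \<bullet> (C *v a)) * (b \<bullet> (C *v b)) + 2 * (a \<bullet> (C *v b))\<^sup>2"
    by (simp add: matrix_vector_right_distrib matrix_vector_mult_diff_distrib inner_add_left inner_add_right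
        inner_diff_left inner_diff_right C power2_eq_square algebra_simps)
  ultimately show ?thesis by (simp only:)
qed

text \<open>The squared norm is a constant plus a linear plus a quadratic form in the Gaussian
  vector. Odd moments vanish, so linear and quadratic parts are uncorrelated and contribute
  separately to the variance. \<open>G\<close> is P C P^T, and the double sum is its squared
  Frobenius norm.\<close>

lemma gaussian_quadratic_moments:
  fixes z :: "'a \<Rightarrow> real^'n" and P :: "real^'n^'k" and m :: "real^'k"
  assumes "gaussian_vector Q z 0 C"
  defines "G \<equiv> \<lambda>i j. P $ i \<bullet> (C *v P $ j)" and "b \<equiv> transpose P *v m"
  shows "has_bochner_integral Q (\<lambda>\<omega>. (norm (m + P *v z \<omega>))\<^sup>2) ((norm m)\<^sup>2 + (\<Sum>i\<in>UNIV. G i i))"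
    and "has_bochner_integral Q (\<lambda>\<omega>. ((norm (m + P *v z \<omega>))\<^sup>2)\<^sup>2)
      (((norm m)\<^sup>2 + (\<Sum>i\<in>UNIV. G i i))\<^sup>2 + 4 * (b \<bullet> (C *v b)) + 2 * (\<Sum>i\<in>UNIV. \<Sum>j\<in>UNIV. (G i j)\<^sup>2))"
proof -
  note mom = gaussian_vector_moments[OF assms(1)]
  define c q where "c = (norm m)\<^sup>2" and "q = (\<lambda>\<omega>. \<Sum>i\<in>UNIV. (P $ i \<bullet> z \<omega>)\<^sup>2)"
  have b: "m \<bullet> (P *v y) = b \<bullet> y" for y
    by (simp add: b_def dot_lmul_matrix)
  have expand: "(norm (m + P *v z \<omega>))\<^sup>2 = c + 2 * (b \<bullet> z \<omega>) + q \<omega>" for \<omega>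
  proof -
    have "(norm (m + P *v z \<omega>))\<^sup>2 = c + 2 * (m \<bullet> (P *v z \<omega>)) + (P *v z \<omega>) \<bullet> (P *v z \<omega>)"
      unfolding power2_norm_eq_inner c_def by (simp add: inner_add_left inner_add_right inner_commute)
    thus ?thesis
      by (simp add: b q_def inner_vec_def[of "P *v z \<omega>"] matrix_vector_mul_component power2_eq_square)
  qed
  have prob: "prob_space Q" using assms(1) by (simp add: gaussian_vector_def)
  hence const: "has_bochner_integral Q (\<lambda>_. r) r" for r :: real
    by (simp add: has_bochner_integral_iff finite_measure.integrable_const prob_space.finite_measure
        prob_space.prob_space)
  have q1: "has_bochner_integral Q q (\<Sum>i\<in>UNIV. G i i)"
    unfolding q_def G_def by (intro has_bochner_integral_sum mom)
  have "has_bochner_integral Q (\<lambda>\<omega>. c + 2 * (b \<bullet> z \<omega>) + q \<omega>) (c + 2 * 0 + (\<Sum>i\<in>UNIV. G i i))"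
    by (intro has_bochner_integral_add const has_bochner_integral_mult_right mom q1)
  thus "has_bochner_integral Q (\<lambda>\<omega>. (norm (m + P *v z \<omega>))\<^sup>2) ((norm m)\<^sup>2 + (\<Sum>i\<in>UNIV. G i i))"
    by (simp add: expand c_def)
  have q2: "has_bochner_integral Q (\<lambda>\<omega>. \<Sum>i\<in>UNIV. \<Sum>j\<in>UNIV. (P $ i \<bullet> z \<omega>)\<^sup>2 * (P $ j \<bullet> z \<omega>)\<^sup>2)
      (\<Sum>i\<in>UNIV. \<Sum>j\<in>UNIV. G i i * G j j + 2 * (G i j)\<^sup>2)"
    unfolding G_def by (intro has_bochner_integral_sum gaussian_vector_mixed_moment_22 assms)
  have qb: "has_bochner_integral Q (\<lambda>\<omega>. \<Sum>i\<in>UNIV. (P $ i \<bullet> z \<omega>)\<^sup>2 * (b \<bullet> z \<omega>)) (\<Sum>i\<in>(UNIV::'k set). 0)"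
    by (intro has_bochner_integral_sum gaussian_vector_mixed_moment_21[OF assms(1)])
  have "has_bochner_integral Q
      (\<lambda>\<omega>. c\<^sup>2 + 4 * (b \<bullet> z \<omega>)\<^sup>2 + (\<Sum>i\<in>UNIV. \<Sum>j\<in>UNIV. (P $ i \<bullet> z \<omega>)\<^sup>2 * (P $ j \<bullet> z \<omega>)\<^sup>2)
        + 4 * c * (b \<bullet> z \<omega>) + 2 * c * q \<omega> + 4 * (\<Sum>i\<in>UNIV. (P $ i \<bullet> z \<omega>)\<^sup>2 * (b \<bullet> z \<omega>)))
      (c\<^sup>2 + 4 * (b \<bullet> (C *v b)) + (\<Sum>i\<in>UNIV. \<Sum>j\<in>UNIV. G i i * G j j + 2 * (G i j)\<^sup>2)
        + 4 * c * 0 + 2 * c * (\<Sum>i\<in>UNIV. G i i) + 4 * (\<Sum>i\<in>(UNIV::'k set). 0))"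
    by (intro has_bochner_integral_add const has_bochner_integral_mult_right mom q1 q2 qb)
  moreover have "((norm (m + P *v z \<omega>))\<^sup>2)\<^sup>2 =
      c\<^sup>2 + 4 * (b \<bullet> z \<omega>)\<^sup>2 + (\<Sum>i\<in>UNIV. \<Sum>j\<in>UNIV. (P $ i \<bullet> z \<omega>)\<^sup>2 * (P $ j \<bullet> z \<omega>)\<^sup>2)
        + 4 * c * (b \<bullet> z \<omega>) + 2 * c * q \<omega> + 4 * (\<Sum>i\<in>UNIV. (P $ i \<bullet> z \<omega>)\<^sup>2 * (b \<bullet> z \<omega>))" for \<omega>
  proof -
    have "(\<Sum>i\<in>UNIV. \<Sum>j\<in>UNIV. (P $ i \<bullet> z \<omega>)\<^sup>2 * (P $ j \<bullet> z \<omega>)\<^sup>2) = q \<omega> * q \<omega>"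
      by (simp add: q_def sum_product)
    moreover have "(\<Sum>i\<in>UNIV. (P $ i \<bullet> z \<omega>)\<^sup>2 * (b \<bullet> z \<omega>)) = q \<omega> * (b \<bullet> z \<omega>)"
      by (simp add: q_def sum_distrib_right)
    ultimately show ?thesis
      unfolding expand by (simp add: power2_eq_square algebra_simps)
  qed
  moreover have "c\<^sup>2 + 4 * (b \<bullet> (C *v b)) + (\<Sum>i\<in>UNIV. \<Sum>j\<in>UNIV. G i i * G j j + 2 * (G i j)\<^sup>2)
        + 4 * c * 0 + 2 * c * (\<Sum>i\<in>UNIV. G i i) + 4 * (\<Sum>i\<in>(UNIV::'k set). 0)
      = (c + (\<Sum>i\<in>UNIV. G i i))\<^sup>2 + 4 * (b \<bullet> (C *v b)) + 2 * (\<Sum>i\<in>UNIV. \<Sum>j\<in>UNIV. (G i j)\<^sup>2)"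
  proof -
    have "(\<Sum>i\<in>UNIV. \<Sum>j\<in>UNIV. G i i * G j j) = (\<Sum>i\<in>UNIV. G i i) * (\<Sum>i\<in>UNIV. G i i)"
      by (simp add: sum_product)
    thus ?thesis by (simp add: sum.distrib power2_sum) (simp add: power2_eq_square sum_distrib_left)
  qed
  ultimately show "has_bochner_integral Q (\<lambda>\<omega>. ((norm (m + P *v z \<omega>))\<^sup>2)\<^sup>2)
      (((norm m)\<^sup>2 + (\<Sum>i\<in>UNIV. G i i))\<^sup>2 + 4 * (b \<bullet> (C *v b)) + 2 * (\<Sum>i\<in>UNIV. \<Sum>j\<in>UNIV. (G i j)\<^sup>2))"
    unfolding c_def by (simp only:)
qed

lemma gaussian_sample_variance:
  fixes z :: "'a \<Rightarrow> real^'n" and x :: "real^'n"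
  assumes "gaussian_vector Q z 0 C"
  defines "m \<equiv> centering *v x" and "G \<equiv> \<lambda>i j. (centering $ i) \<bullet> (C *v centering $ j)"
  shows "prob_space.expectation Q (\<lambda>\<omega>. sample_variance (x + z \<omega>))
      = ((norm m)\<^sup>2 + (\<Sum>i\<in>UNIV. G i i)) / (real CARD('n) - 1)"
    and "prob_space.variance Q (\<lambda>\<omega>. sample_variance (x + z \<omega>))
      = (4 * ((transpose centering *v m) \<bullet> (C *v (transpose centering *v m)))
         + 2 * (\<Sum>i\<in>UNIV. \<Sum>j\<in>UNIV. (G i j)\<^sup>2)) / (real CARD('n) - 1)\<^sup>2"
proof -
  let ?s = "\<lambda>\<omega>. sample_variance (x + z \<omega>)"
  let ?E = "((norm m)\<^sup>2 + (\<Sum>i\<in>UNIV. G i i)) / (real CARD('n) - 1)"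
  have s: "?s \<omega> = (norm (m + centering *v z \<omega>))\<^sup>2 * (1 / (real CARD('n) - 1))" for \<omega>
    by (simp add: sample_variance_def m_def matrix_vector_right_distrib)
  note mom = gaussian_quadratic_moments[OF assms(1), of m centering]
  have 1: "has_bochner_integral Q ?s ?E"
    using has_bochner_integral_mult_left[OF mom(1), of "1 / (real CARD('n) - 1)"]
    unfolding s G_def by simp
  have 2: "has_bochner_integral Q (\<lambda>\<omega>. (?s \<omega>)\<^sup>2) ((((norm m)\<^sup>2 + (\<Sum>i\<in>UNIV. G i i))\<^sup>2
      + 4 * ((transpose centering *v m) \<bullet> (C *v (transpose centering *v m)))
      + 2 * (\<Sum>i\<in>UNIV. \<Sum>j\<in>UNIV. (G i j)\<^sup>2)) / (real CARD('n) - 1)\<^sup>2)"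
    using has_bochner_integral_mult_left[OF mom(2), of "1 / (real CARD('n) - 1)\<^sup>2"]
    unfolding s G_def power_mult_distrib by (simp add: power_one_over)
  have prob: "prob_space Q" using assms(1) by (simp add: gaussian_vector_def)
  from 1 show E: "prob_space.expectation Q ?s = ?E" by (rule has_bochner_integral_integral_eq)
  have "prob_space.variance Q ?s = prob_space.expectation Q (\<lambda>\<omega>. (?s \<omega>)\<^sup>2) - (prob_space.expectation Q ?s)\<^sup>2"
    using 1 2 by (intro prob_space.variance_eq[OF prob]) (auto simp: has_bochner_integral_iff)
  thus "prob_space.variance Q ?s
      = (4 * ((transpose centering *v m) \<bullet> (C *v (transpose centering *v m)))
         + 2 * (\<Sum>i\<in>UNIV. \<Sum>j\<in>UNIV. (G i j)\<^sup>2)) / (real CARD('n) - 1)\<^sup>2"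
    unfolding E has_bochner_integral_integral_eq[OF 2]
    by (simp add: power_divide diff_divide_distrib[symmetric])
qed

section \<open>The coefficient of variation of the sample variance\<close>

text \<open>The Jacobian in \<open>x\<close> is the joint derivative restricted to directions (h,
  0), and the joint derivative is continuous at the endpoint because it is differentiable there. The
  limit serves to bound the drift matrix and to pass to the limit in the eigenvector
  equation.\<close>

lemma drift_matrix_tendsto:
  fixes F :: "real^'n \<Rightarrow> real \<Rightarrow> real^'n"
  assumes smooth: "C2_on (\<lambda>(x, \<alpha>). F x \<alpha>) U" and U: "(xc, \<alpha>c) \<in> U"
    and xs: "(xs \<longlongrightarrow> xc) (at_left \<alpha>c)"
  obtains M where "(drift_matrix F xs \<longlongrightarrow> M) (at_left \<alpha>c)"
proof -
  obtain f' f'' where op: "open U"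
    and f': "\<And>p. p \<in> U \<Longrightarrow> ((\<lambda>(x, \<alpha>). F x \<alpha>) has_derivative blinfun_apply (f' p)) (at p)"
    and f'': "\<And>p. p \<in> U \<Longrightarrow> (f' has_derivative blinfun_apply (f'' p)) (at p)"
    using smooth unfolding C2_on_def by auto
  have lim: "((\<lambda>\<alpha>. (xs \<alpha>, \<alpha>)) \<longlongrightarrow> (xc, \<alpha>c)) (at_left \<alpha>c)"
    by (intro tendsto_Pair xs tendsto_ident_at)
  have "isCont f' (xc, \<alpha>c)" using f''[OF U] by (rule has_derivative_continuous)
  hence f'_lim: "((\<lambda>\<alpha>. f' (xs \<alpha>, \<alpha>)) \<longlongrightarrow> f' (xc, \<alpha>c)) (at_left \<alpha>c)"
    using lim by (rule isCont_tendsto_compose)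
  have ev: "\<forall>\<^sub>F \<alpha> in at_left \<alpha>c. (xs \<alpha>, \<alpha>) \<in> U"
    using topological_tendstoD[OF lim op U] .
  have drift: "drift_matrix F xs \<alpha> = - (\<chi> i j. f' (xs \<alpha>, \<alpha>) (axis j 1, 0) $ i)" if "(xs \<alpha>, \<alpha>) \<in> U" for \<alpha>
  proof -
    have "((\<lambda>x. (\<lambda>(x, \<alpha>). F x \<alpha>) (x, \<alpha>)) has_derivative (\<lambda>h. f' (xs \<alpha>, \<alpha>) (h, 0))) (at (xs \<alpha>))"
      by (rule has_derivative_compose[of "\<lambda>x. (x, \<alpha>)" "\<lambda>h. (h, 0)"])
        (auto intro!: derivative_eq_intros f' that)
    hence "frechet_derivative (\<lambda>x. F x \<alpha>) (at (xs \<alpha>)) = (\<lambda>h. f' (xs \<alpha>, \<alpha>) (h, 0))"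
      by (simp add: frechet_derivative_at[symmetric])
    thus ?thesis by (simp add: drift_matrix_def jacobian_def matrix_def)
  qed
  show thesis
  proof (rule that, rule Lim_transform_eventually)
    show "((\<lambda>\<alpha>. - (\<chi> i j. f' (xs \<alpha>, \<alpha>) (axis j 1, 0) $ i))
        \<longlongrightarrow> - (\<chi> i j. f' (xc, \<alpha>c) (axis j 1, 0) $ i)) (at_left \<alpha>c)"
      by (intro tendsto_intros f'_lim)
    show "\<forall>\<^sub>F \<alpha> in at_left \<alpha>c. - (\<chi> i j. f' (xs \<alpha>, \<alpha>) (axis j 1, 0) $ i) = drift_matrix F xs \<alpha>"
      using ev by eventually_elim (simp add: drift)
  qed
qed

lemma centering_mult_component:
  fixes x :: "real^'n"
  shows "(centering *v x) $ i = x $ i - (\<Sum>j\<in>UNIV. x $ j) / real CARD('n)"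
  unfolding centering_def matrix_vector_mult_diff_rdistrib matrix_vector_mul_lid
  by (simp add: matrix_vector_mult_def sum_divide_distrib)

text \<open>This makes the limit well-defined: a real matrix has no constant eigenvector for a non-real
  eigenvalue, so the centering cannot annihilate the Hopf plane.\<close>

lemma centering_rotation_plane_nonzero:
  fixes M :: "real^'n^'n"
  assumes "M *v p = - \<Omega> *\<^sub>R q" "M *v q = \<Omega> *\<^sub>R p" "\<Omega> \<noteq> 0" "p \<noteq> 0 \<or> q \<noteq> 0"
  shows "centering *v p \<noteq> 0 \<or> centering *v q \<noteq> 0"
proof (rule ccontr)
  assume "\<not> ?thesis"
  hence mean: "p $ i = (\<Sum>j\<in>UNIV. p $ j) / real CARD('n)" "q $ i = (\<Sum>j\<in>UNIV. q $ j) / real CARD('n)" for i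
    using centering_mult_component[of p i] centering_mult_component[of q i] by simp_all
  obtain a b where ab: "\<And>i. p $ i = a" "\<And>i. q $ i = b" using mean by blast
  \<comment> \<open>Both vectors are constant, so this combination vanishes, while every component
    of its image under \<open>M\<close> is -\<Omega> (a^2 + b^2).\<close>
  hence "b *\<^sub>R p - a *\<^sub>R q = 0" by (simp add: vec_eq_iff)
  hence "M *v (b *\<^sub>R p - a *\<^sub>R q) = 0" by simp
  moreover have "M *v (b *\<^sub>R p - a *\<^sub>R q) = - (\<Omega> *\<^sub>R (b *\<^sub>R q + a *\<^sub>R p))"
    by (simp add: matrix_vector_mult_diff_distrib matrix_vector_mult_scaleR assms(1,2) algebra_simps)
  ultimately have "\<Omega> *\<^sub>R (b *\<^sub>R q + a *\<^sub>R p) = 0" by simp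
  hence "a\<^sup>2 + b\<^sup>2 = 0"
    using assms(3) by (simp add: vec_eq_iff ab power2_eq_square)
  hence "p = 0" "q = 0" by (auto simp: sum_power2_eq_zero_iff vec_eq_iff ab)
  thus False using assms(4) by simp
qed

section \<open>Traces and eigenvalues of the Gram matrix, bounds for the limit\<close>

lemma trace_hopf_gram:
  "trace (hopf_gram v) = (norm (centering *v Re_vec v))\<^sup>2 + (norm (centering *v Im_vec v))\<^sup>2"
  by (simp add: hopf_gram_def trace_def sum_2 Let_def)

lemma trace_hopf_gram_sq:
  "trace (hopf_gram v ** hopf_gram v) = ((norm (centering *v Re_vec v))\<^sup>2)\<^sup>2
     + 2 * ((centering *v Re_vec v) \<bullet> (centering *v Im_vec v))\<^sup>2 + ((norm (centering *v Im_vec v))\<^sup>2)\<^sup>2"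
  by (simp add: hopf_gram_def trace_def sum_2 Let_def matrix_matrix_mult_def power2_eq_square)

lemma charpoly_2:
  fixes A :: "'a::field^2^2"
  shows "charpoly A = [:A $ 1 $ 1 * A $ 2 $ 2 - A $ 1 $ 2 * A $ 2 $ 1, - (A $ 1 $ 1 + A $ 2 $ 2), 1:]"
  by (simp add: charpoly_def det_2 mat_def algebra_simps)

text \<open>Comparing coefficients gives trace and determinant, and tr(A^2) = (tr A)^2 - 2 det A.
  Factoring the characteristic polynomial counts the eigenvalues with multiplicity.\<close>

lemma charpoly_2_roots:
  fixes A :: "'a::field^2^2"
  assumes "charpoly A = [:- \<nu>1, 1:] * [:- \<nu>2, 1:]"
  shows "trace A = \<nu>1 + \<nu>2" "trace (A ** A) = \<nu>1\<^sup>2 + \<nu>2\<^sup>2"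
proof -
  have *: "A $ 1 $ 1 * A $ 2 $ 2 - A $ 1 $ 2 * A $ 2 $ 1 = \<nu>1 * \<nu>2"
    using arg_cong[OF assms, of "\<lambda>p. coeff p 0"] by (simp add: charpoly_2)
  have "- (A $ 1 $ 1 + A $ 2 $ 2) = - (\<nu>1 + \<nu>2)"
    using arg_cong[OF assms, of "\<lambda>p. coeff p 1"] by (simp add: charpoly_2)
  hence tr: "A $ 1 $ 1 + A $ 2 $ 2 = \<nu>1 + \<nu>2"
    by (simp only: neg_equal_iff_equal)
  show "trace A = \<nu>1 + \<nu>2" using tr by (simp add: trace_def sum_2)
  have "trace (A ** A) = (A $ 1 $ 1 + A $ 2 $ 2)\<^sup>2 - 2 * (A $ 1 $ 1 * A $ 2 $ 2 - A $ 1 $ 2 * A $ 2 $ 1)"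
    by (simp add: trace_def sum_2 matrix_matrix_mult_def power2_eq_square algebra_simps)
  also have "\<dots> = \<nu>1\<^sup>2 + \<nu>2\<^sup>2"
    unfolding * tr by (simp add: power2_eq_square algebra_simps)
  finally show "trace (A ** A) = \<nu>1\<^sup>2 + \<nu>2\<^sup>2" .
qed

text \<open>By symmetry the discriminant is a sum of squares, so the quadratic formula applies over
  the reals.\<close>

lemma charpoly_symmetric_2_splits:
  fixes A :: "real^2^2"
  assumes "A $ 1 $ 2 = A $ 2 $ 1"
  shows "\<exists>\<nu>1 \<nu>2. charpoly A = [:- \<nu>1, 1:] * [:- \<nu>2, 1:]"
proof -
  define s where "s = sqrt ((A $ 1 $ 1 - A $ 2 $ 2)\<^sup>2 + 4 * (A $ 2 $ 1)\<^sup>2)"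
  have "s * s = (A $ 1 $ 1 - A $ 2 $ 2)\<^sup>2 + 4 * (A $ 2 $ 1)\<^sup>2"
    unfolding s_def by (simp flip: power2_eq_square)
  hence "charpoly A = [:- ((A $ 1 $ 1 + A $ 2 $ 2 + s) / 2), 1:] * [:- ((A $ 1 $ 1 + A $ 2 $ 2 - s) / 2), 1:]"
    by (simp add: charpoly_2 assms power2_eq_square field_simps)
  thus ?thesis by blast
qed

text \<open>With A the Gram matrix of \<open>a\<close> and \<open>b\<close>, the lower bound holds
  because 2 tr(A^2) - (tr A)^2 is a sum of squares. The upper bound, tr(A^2) at most (tr A)^2, is
  Cauchy-Schwarz.\<close>

lemma gram_ratio_bounds:
  fixes a b :: "'a::real_inner"
  assumes "a \<noteq> 0 \<or> b \<noteq> 0"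
  defines "L \<equiv> sqrt (2 * (((norm a)\<^sup>2)\<^sup>2 + 2 * (a \<bullet> b)\<^sup>2 + ((norm b)\<^sup>2)\<^sup>2)) / ((norm a)\<^sup>2 + (norm b)\<^sup>2)"
  shows "1 \<le> L" "L \<le> sqrt 2"
proof -
  let ?T = "(norm a)\<^sup>2 + (norm b)\<^sup>2"
  let ?Q = "((norm a)\<^sup>2)\<^sup>2 + 2 * (a \<bullet> b)\<^sup>2 + ((norm b)\<^sup>2)\<^sup>2"
  have pos: "0 < ?T" using assms(1) by (auto simp: add_pos_nonneg add_nonneg_pos)
  have "0 \<le> ((norm a)\<^sup>2 - (norm b)\<^sup>2)\<^sup>2 + 4 * (a \<bullet> b)\<^sup>2" by simp
  also have "\<dots> = 2 * ?Q - ?T\<^sup>2" by (simp add: power2_eq_square algebra_simps)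
  finally have "?T \<le> sqrt (2 * ?Q)" by (intro real_le_rsqrt) simp
  thus "1 \<le> L" using pos by (simp add: L_def)
  have "(a \<bullet> b)\<^sup>2 \<le> (norm a)\<^sup>2 * (norm b)\<^sup>2"
    using Cauchy_Schwarz_ineq[of a b] by (simp add: power2_norm_eq_inner)
  hence "2 * ?Q \<le> 2 * ?T\<^sup>2" by (simp add: power2_sum)
  hence "sqrt (2 * ?Q) \<le> sqrt (2 * ?T\<^sup>2)" by (rule real_sqrt_le_mono)
  also have "\<dots> = sqrt 2 * ?T" using pos by (simp add: real_sqrt_mult)
  finally show "L \<le> sqrt 2" using pos by (simp add: L_def divide_le_eq)
qed

theorem theoremE6:
  fixes F :: "real^'n \<Rightarrow> real \<Rightarrow> real^'n"
    and B :: "real^'m^'n"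
    and xs :: "real \<Rightarrow> real^'n" and xc :: "real^'n"
    and \<alpha>0 \<alpha>c :: real
    and U :: "((real^'n) \<times> real) set"
    and C :: "real \<Rightarrow> real^'n^'n"
    and \<eta> \<Omega> :: "real \<Rightarrow> real" and \<Omega>c \<delta> :: real
    and vH wH :: "real \<Rightarrow> complex^'n" and vHc wHc :: "complex^'n"
    and \<sigma>2 :: real
    and Q :: "real \<Rightarrow> 'a measure" and z :: "real \<Rightarrow> 'a \<Rightarrow> real^'n"
  assumes dim: "2 \<le> CARD('n)"
    and interval: "\<alpha>0 < \<alpha>c"
    \<comment> \<open>branch of asymptotically stable equilibria with a finite endpoint\<close>
    and equilibrium: "\<And>\<alpha>. \<alpha> \<in> {\<alpha>0<..<\<alpha>c} \<Longrightarrow> F (xs \<alpha>) \<alpha> = 0"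
    and stable: "\<And>\<alpha>. \<alpha> \<in> {\<alpha>0<..<\<alpha>c} \<Longrightarrow> asymptotically_stable (\<lambda>x. F x \<alpha>) (xs \<alpha>)"
    and endpoint: "(xs \<longlongrightarrow> xc) (at_left \<alpha>c)"
    and smooth: "C2_on (\<lambda>(x, \<alpha>). F x \<alpha>) U"
    and branch_in_U: "\<And>\<alpha>. \<alpha> \<in> {\<alpha>0<..<\<alpha>c} \<Longrightarrow> (xs \<alpha>, \<alpha>) \<in> U"
    and endpoint_in_U: "(xc, \<alpha>c) \<in> U"
    \<comment> \<open>Lyapunov equation\<close>
    and lyapunov: "\<forall>\<^sub>F \<alpha> in at_left \<alpha>c.
          drift_matrix F xs \<alpha> ** C \<alpha> + C \<alpha> ** transpose (drift_matrix F xs \<alpha>) = B ** transpose B"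
    \<comment> \<open>simple Hopf pair\<close>
    and diag: "\<forall>\<^sub>F \<alpha> in at_left \<alpha>c. diagonalizable (cmat (drift_matrix F xs \<alpha>))"
    and simple: "\<forall>\<^sub>F \<alpha> in at_left \<alpha>c.
          simple_eigenvalue (cmat (drift_matrix F xs \<alpha>)) (Complex (\<eta> \<alpha>) (\<Omega> \<alpha>)) \<and>
          simple_eigenvalue (cmat (drift_matrix F xs \<alpha>)) (Complex (\<eta> \<alpha>) (- \<Omega> \<alpha>))"
    and eta_pos: "\<forall>\<^sub>F \<alpha> in at_left \<alpha>c. 0 < \<eta> \<alpha>"
    and eta_lim: "(\<eta> \<longlongrightarrow> 0) (at_left \<alpha>c)"
    and Omega_lim: "(\<Omega> \<longlongrightarrow> \<Omega>c) (at_left \<alpha>c)"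
    and Omega_c_pos: "0 < \<Omega>c"
    and delta_pos: "0 < \<delta>"
    and gap: "\<forall>\<^sub>F \<alpha> in at_left \<alpha>c. \<forall>\<mu>. eigenvalue (cmat (drift_matrix F xs \<alpha>)) \<mu> \<longrightarrow>
          \<mu> \<noteq> Complex (\<eta> \<alpha>) (\<Omega> \<alpha>) \<longrightarrow> \<mu> \<noteq> Complex (\<eta> \<alpha>) (- \<Omega> \<alpha>) \<longrightarrow> \<delta> \<le> Re \<mu>"
    and right: "\<forall>\<^sub>F \<alpha> in at_left \<alpha>c.
          right_eigenvector (cmat (drift_matrix F xs \<alpha>)) (Complex (\<eta> \<alpha>) (\<Omega> \<alpha>)) (vH \<alpha>) \<and>
          right_eigenvector (cmat (drift_matrix F xs \<alpha>)) (Complex (\<eta> \<alpha>) (- \<Omega> \<alpha>)) (cnj_vec (vH \<alpha>))"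
    and left: "\<forall>\<^sub>F \<alpha> in at_left \<alpha>c.
          left_eigenvector (cmat (drift_matrix F xs \<alpha>)) (Complex (\<eta> \<alpha>) (\<Omega> \<alpha>)) (wH \<alpha>) \<and>
          left_eigenvector (cmat (drift_matrix F xs \<alpha>)) (Complex (\<eta> \<alpha>) (- \<Omega> \<alpha>)) (cnj_vec (wH \<alpha>))"
    and normalized: "\<forall>\<^sub>F \<alpha> in at_left \<alpha>c.
          norm (vH \<alpha>) = 1 \<and> tdot (wH \<alpha>) (vH \<alpha>) = 1 \<and> tdot (wH \<alpha>) (cnj_vec (vH \<alpha>)) = 0"
    and vH_lim: "(vH \<longlongrightarrow> vHc) (at_left \<alpha>c)"
    and wH_lim: "(wH \<longlongrightarrow> wHc) (at_left \<alpha>c)"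
    \<comment> \<open>non-degenerate noise along the Hopf pair\<close>
    and sigma_lim: "((\<lambda>\<alpha>. (norm (cmat (transpose B) *v wH \<alpha>))\<^sup>2) \<longlongrightarrow> \<sigma>2) (at_left \<alpha>c)"
    and sigma_pos: "0 < \<sigma>2"
    \<comment> \<open>Gaussian fluctuations\<close>
    and gauss: "\<forall>\<^sub>F \<alpha> in at_left \<alpha>c. gaussian_vector (Q \<alpha>) (z \<alpha>) 0 (C \<alpha>)"
  shows "let V = (\<lambda>\<alpha> \<omega>. sample_variance (xs \<alpha> + z \<alpha> \<omega>));
             A = hopf_gram vHc;
             L = sqrt (2 * trace (A ** A)) / trace A
         in ((\<lambda>\<alpha>. sd (Q \<alpha>) (V \<alpha>) / prob_space.expectation (Q \<alpha>) (V \<alpha>)) \<longlongrightarrow> L) (at_left \<alpha>c) \<and>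
            (\<exists>\<nu>1 \<nu>2. charpoly A = [:- \<nu>1, 1:] * [:- \<nu>2, 1:]) \<and>
            (\<forall>\<nu>1 \<nu>2. charpoly A = [:- \<nu>1, 1:] * [:- \<nu>2, 1:] \<longrightarrow>
               L = sqrt (2 * (\<nu>1\<^sup>2 + \<nu>2\<^sup>2)) / (\<nu>1 + \<nu>2)) \<and>
            1 \<le> L \<and> L \<le> sqrt 2"
proof -
  let ?l = "at_left \<alpha>c"
  define M where "M = drift_matrix F xs"
  define p q where "p = Re_vec vHc" and "q = Im_vec vHc"
  define Pp Pq where "Pp = centering *v p" and "Pq = centering *v q"
  obtain Mc where Mc: "(M \<longlongrightarrow> Mc) ?l"
    unfolding M_def by (rule drift_matrix_tendsto[OF smooth endpoint_in_U endpoint])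
  have hopf: "\<forall>\<^sub>F \<alpha> in ?l. hopf_pair (M \<alpha>) (\<eta> \<alpha>) (\<Omega> \<alpha>) \<delta> (vH \<alpha>) (wH \<alpha>)"
    using diag simple gap right left normalized
    by eventually_elim (unfold_locales, auto simp: M_def delta_pos)
  have M_bound: "\<forall>\<^sub>F \<alpha> in ?l. norm (M \<alpha>) \<le> norm Mc + 1"
  proof -
    have "\<forall>\<^sub>F \<alpha> in ?l. norm (M \<alpha>) < norm Mc + 1"
      using tendsto_norm[OF Mc] by (rule order_tendstoD) simp
    thus ?thesis by eventually_elim simp
  qed
  have sym: "\<forall>\<^sub>F \<alpha> in ?l. transpose (C \<alpha>) = C \<alpha>" and psd: "\<forall>\<^sub>F \<alpha> in ?l. \<forall>a. 0 \<le> a \<bullet> (C \<alpha> *v a)"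
    using gauss by (eventually_elim, simp add: gaussian_vector_def)+
  have quad: "((\<lambda>\<alpha>. \<eta> \<alpha> * (a \<bullet> (C \<alpha> *v a))) \<longlongrightarrow> \<sigma>2 * ((p \<bullet> a)\<^sup>2 + (q \<bullet> a)\<^sup>2)) ?l" for a
    unfolding p_def q_def
    by (rule rescaled_covariance_quadratic_tendsto[OF delta_pos hopf M_bound lyapunov[folded M_def] sym psd
          eta_pos eta_lim Omega_lim _ vH_lim wH_lim sigma_lim]) (use Omega_c_pos in simp)
  note cov = rescaled_covariance_tendsto[OF sym quad]

  define G where "G = (\<lambda>\<alpha> i j. (centering $ i :: real^'n) \<bullet> (C \<alpha> *v centering $ j))"
  have dot: "p \<bullet> centering $ i = Pp $ i" "q \<bullet> centering $ i = Pq $ i" for i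
    by (simp_all add: Pp_def Pq_def matrix_vector_mul_component inner_commute)
  have G: "((\<lambda>\<alpha>. \<eta> \<alpha> * G \<alpha> i j) \<longlongrightarrow> \<sigma>2 * (Pp $ i * Pp $ j + Pq $ i * Pq $ j)) ?l" for i j
    using cov[of "centering $ i" "centering $ j"] by (simp only: G_def dot)
  define m where "m = (\<lambda>\<alpha>. centering *v xs \<alpha>)"
  define b where "b = (\<lambda>\<alpha>. transpose centering *v m \<alpha>)"
  have m: "(m \<longlongrightarrow> centering *v xc) ?l"
    unfolding m_def by (intro tendsto_matrix_vector_mult tendsto_const endpoint)
  have b: "(b \<longlongrightarrow> transpose centering *v (centering *v xc)) ?l"
    unfolding b_def by (intro tendsto_matrix_vector_mult tendsto_const m)
  \<comment> \<open>The equilibrium enters the variance through this term. Since \<eta> C converges,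
    scaling by \<eta>^2 leaves a spare factor \<eta>.\<close>
  have bCb: "((\<lambda>\<alpha>. \<eta> \<alpha> * (\<eta> \<alpha> * (b \<alpha> \<bullet> (C \<alpha> *v b \<alpha>)))) \<longlongrightarrow> 0) ?l"
  proof -
    define S where "S = (\<chi> i j. \<sigma>2 * (p $ i * p $ j + q $ i * q $ j))"
    have "((\<lambda>\<alpha>. \<eta> \<alpha> * C \<alpha> $ i $ j) \<longlongrightarrow> S $ i $ j) ?l" for i j
      using cov[of "axis i 1" "axis j 1"]
      by (simp add: S_def inner_axis inner_axis' matrix_vector_mult_basis column_def)
    hence S: "((\<lambda>\<alpha>. \<eta> \<alpha> *\<^sub>R C \<alpha>) \<longlongrightarrow> S) ?l"
      by (intro vec_tendstoI) simp
    have "((\<lambda>\<alpha>. \<eta> \<alpha> * (b \<alpha> \<bullet> ((\<eta> \<alpha> *\<^sub>R C \<alpha>) *v b \<alpha>))) \<longlongrightarrow> 0) ?l"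
      by (rule tendsto_eq_intros tendsto_matrix_vector_mult S b eta_lim refl | simp)+
    thus ?thesis by (simp flip: scaleR_matrix_vector_assoc)
  qed

  let ?V = "\<lambda>\<alpha> \<omega>. sample_variance (xs \<alpha> + z \<alpha> \<omega>)"
  let ?A = "hopf_gram vHc"
  \<comment> \<open>Mean and variance up to the factors N - 1 and (N - 1)^2, which cancel in the
    quotient of standard deviation and mean.\<close>
  define e where "e = (\<lambda>\<alpha>. (norm (m \<alpha>))\<^sup>2 + (\<Sum>i\<in>UNIV. G \<alpha> i i))"
  define W where "W = (\<lambda>\<alpha>. 4 * (b \<alpha> \<bullet> (C \<alpha> *v b \<alpha>)) + 2 * (\<Sum>i\<in>UNIV. \<Sum>j\<in>UNIV. (G \<alpha> i j)\<^sup>2))"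
  have e_lim: "((\<lambda>\<alpha>. \<eta> \<alpha> * e \<alpha>) \<longlongrightarrow> \<sigma>2 * trace ?A) ?l"
  proof -
    have "((\<lambda>\<alpha>. \<eta> \<alpha> * (norm (m \<alpha>))\<^sup>2 + (\<Sum>i\<in>UNIV. \<eta> \<alpha> * G \<alpha> i i))
        \<longlongrightarrow> 0 * (norm (centering *v xc))\<^sup>2 + (\<Sum>i\<in>UNIV. \<sigma>2 * (Pp $ i * Pp $ i + Pq $ i * Pq $ i))) ?l"
      by (intro tendsto_intros eta_lim m G)
    moreover have "(\<Sum>i\<in>UNIV. \<sigma>2 * (Pp $ i * Pp $ i + Pq $ i * Pq $ i)) = \<sigma>2 * trace ?A"
      by (simp only: trace_hopf_gram power2_norm_eq_inner inner_vec_def inner_real_def sum.distrib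
          sum_distrib_left[symmetric] Pp_def Pq_def p_def q_def)
    ultimately show ?thesis by (simp add: e_def distrib_left sum_distrib_left)
  qed
  have W_lim: "((\<lambda>\<alpha>. (\<eta> \<alpha>)\<^sup>2 * W \<alpha>) \<longlongrightarrow> \<sigma>2\<^sup>2 * (2 * trace (?A ** ?A))) ?l"
  proof -
    have "((\<lambda>\<alpha>. 4 * (\<eta> \<alpha> * (\<eta> \<alpha> * (b \<alpha> \<bullet> (C \<alpha> *v b \<alpha>)))) + 2 * (\<Sum>i\<in>UNIV. \<Sum>j\<in>UNIV. (\<eta> \<alpha> * G \<alpha> i j)\<^sup>2))
        \<longlongrightarrow> 4 * 0 + 2 * (\<Sum>i\<in>UNIV. \<Sum>j\<in>UNIV. (\<sigma>2 * (Pp $ i * Pp $ j + Pq $ i * Pq $ j))\<^sup>2)) ?l"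
      by (intro tendsto_intros bCb G)
    moreover have "(\<Sum>i\<in>UNIV. \<Sum>j\<in>UNIV. (\<sigma>2 * (Pp $ i * Pp $ j + Pq $ i * Pq $ j))\<^sup>2)
        = \<sigma>2\<^sup>2 * trace (?A ** ?A)"
    proof -
      \<comment> \<open>The double sum is the squared Frobenius norm of Pp Pp^T + Pq Pq^T. It equals
        the trace of the squared 2x2 Gram matrix, since the sums over \<open>i\<close> and
        \<open>j\<close> factor into inner products.\<close>
      have prod: "(\<Sum>i\<in>UNIV. \<Sum>j\<in>UNIV. (x $ i * x' $ i) * (x $ j * x' $ j)) = (x \<bullet> x')\<^sup>2" for x x' :: "real^'n"
        by (simp add: inner_vec_def power2_eq_square sum_product)
      have "(Pp $ i * Pp $ j + Pq $ i * Pq $ j)\<^sup>2 = (Pp $ i * Pp $ i) * (Pp $ j * Pp $ j)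
          + 2 * ((Pp $ i * Pq $ i) * (Pp $ j * Pq $ j)) + (Pq $ i * Pq $ i) * (Pq $ j * Pq $ j)" for i j
        by (simp add: power2_eq_square algebra_simps)
      hence "(\<Sum>i\<in>UNIV. \<Sum>j\<in>UNIV. (\<sigma>2 * (Pp $ i * Pp $ j + Pq $ i * Pq $ j))\<^sup>2)
          = \<sigma>2\<^sup>2 * ((Pp \<bullet> Pp)\<^sup>2 + 2 * (Pp \<bullet> Pq)\<^sup>2 + (Pq \<bullet> Pq)\<^sup>2)"
        unfolding prod[symmetric] power_mult_distrib
        by (simp only: sum.distrib sum_distrib_left[symmetric])
      thus ?thesis
        by (simp add: trace_hopf_gram_sq power2_norm_eq_inner Pp_def Pq_def p_def q_def)
    qed
    moreover have "4 * (\<eta> \<alpha> * (\<eta> \<alpha> * (b \<alpha> \<bullet> (C \<alpha> *v b \<alpha>)))) + 2 * (\<Sum>i\<in>UNIV. \<Sum>j\<in>UNIV. (\<eta> \<alpha> * G \<alpha> i j)\<^sup>2)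
        = (\<eta> \<alpha>)\<^sup>2 * W \<alpha>" for \<alpha>
      unfolding power_mult_distrib sum_distrib_left[symmetric] W_def
      by (simp add: power2_eq_square algebra_simps)
    ultimately show ?thesis by (simp add: mult.left_commute)
  qed

  \<comment> \<open>The eigenvector equation and the normalization of \<open>vH\<close> pass to the
    limit, where \<eta> = 0 leaves a pure rotation on a nonzero plane.\<close>
  have nonzero: "Pp \<noteq> 0 \<or> Pq \<noteq> 0"
    unfolding Pp_def Pq_def
  proof (rule centering_rotation_plane_nonzero)
    have nt: "?l \<noteq> bot" by simp
    have Mp: "((\<lambda>\<alpha>. M \<alpha> *v Re_vec (vH \<alpha>)) \<longlongrightarrow> Mc *v p) ?l"
      and Mq: "((\<lambda>\<alpha>. M \<alpha> *v Im_vec (vH \<alpha>)) \<longlongrightarrow> Mc *v q) ?l"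
      unfolding p_def q_def
      by (intro tendsto_matrix_vector_mult Mc tendsto_Re_vec tendsto_Im_vec vH_lim)+
    show "Mc *v p = - \<Omega>c *\<^sub>R q"
    proof (rule tendsto_unique[OF nt Mp], rule Lim_transform_eventually)
      show "((\<lambda>\<alpha>. \<eta> \<alpha> *\<^sub>R Re_vec (vH \<alpha>) - \<Omega> \<alpha> *\<^sub>R Im_vec (vH \<alpha>)) \<longlongrightarrow> - \<Omega>c *\<^sub>R q) ?l"
        unfolding q_def
        by (rule tendsto_eq_intros tendsto_Re_vec tendsto_Im_vec vH_lim eta_lim Omega_lim refl | simp)+
      show "\<forall>\<^sub>F \<alpha> in ?l. \<eta> \<alpha> *\<^sub>R Re_vec (vH \<alpha>) - \<Omega> \<alpha> *\<^sub>R Im_vec (vH \<alpha>) = M \<alpha> *v Re_vec (vH \<alpha>)"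
        using hopf by eventually_elim (simp add: hopf_pair.right_real)
    qed
    show "Mc *v q = \<Omega>c *\<^sub>R p"
    proof (rule tendsto_unique[OF nt Mq], rule Lim_transform_eventually)
      show "((\<lambda>\<alpha>. \<Omega> \<alpha> *\<^sub>R Re_vec (vH \<alpha>) + \<eta> \<alpha> *\<^sub>R Im_vec (vH \<alpha>)) \<longlongrightarrow> \<Omega>c *\<^sub>R p) ?l"
        unfolding p_def
        by (rule tendsto_eq_intros tendsto_Re_vec tendsto_Im_vec vH_lim eta_lim Omega_lim refl | simp)+
      show "\<forall>\<^sub>F \<alpha> in ?l. \<Omega> \<alpha> *\<^sub>R Re_vec (vH \<alpha>) + \<eta> \<alpha> *\<^sub>R Im_vec (vH \<alpha>) = M \<alpha> *v Im_vec (vH \<alpha>)"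
        using hopf by eventually_elim (simp add: hopf_pair.right_real)
    qed
    have "norm vHc = 1"
    proof (rule tendsto_unique[OF nt tendsto_norm[OF vH_lim]], rule Lim_transform_eventually)
      show "((\<lambda>_. 1) \<longlongrightarrow> (1 :: real)) ?l" by simp
      show "\<forall>\<^sub>F \<alpha> in ?l. 1 = norm (vH \<alpha>)" using normalized by eventually_elim simp
    qed
    thus "p \<noteq> 0 \<or> q \<noteq> 0"
      using norm_complex_vec_sq[of vHc] by (auto simp: p_def q_def)
  qed (use Omega_c_pos in simp)
  hence trace_pos: "0 < trace ?A"
    by (auto simp: trace_hopf_gram Pp_def Pq_def p_def q_def add_pos_nonneg add_nonneg_pos)
  define L where "L = sqrt (2 * trace (?A ** ?A)) / trace ?A"
  have "((\<lambda>\<alpha>. sd (Q \<alpha>) (?V \<alpha>) / prob_space.expectation (Q \<alpha>) (?V \<alpha>)) \<longlongrightarrow> L) ?l"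
  proof (rule Lim_transform_eventually)
    \<comment> \<open>Numerator and denominator are both scaled by \<eta>; in the limit the noise
      strength \<open>\<sigma>2\<close> cancels as well.\<close>
    have "((\<lambda>\<alpha>. sqrt ((\<eta> \<alpha>)\<^sup>2 * W \<alpha>) / (\<eta> \<alpha> * e \<alpha>))
        \<longlongrightarrow> sqrt (\<sigma>2\<^sup>2 * (2 * trace (?A ** ?A))) / (\<sigma>2 * trace ?A)) ?l"
      using sigma_pos trace_pos by (intro tendsto_intros W_lim e_lim) simp
    moreover have "sqrt (\<sigma>2\<^sup>2 * (2 * trace (?A ** ?A))) / (\<sigma>2 * trace ?A) = L"
      unfolding L_def real_sqrt_mult[of "\<sigma>2\<^sup>2"] using sigma_pos by simp
    ultimately show "((\<lambda>\<alpha>. sqrt ((\<eta> \<alpha>)\<^sup>2 * W \<alpha>) / (\<eta> \<alpha> * e \<alpha>)) \<longlongrightarrow> L) ?l" by simp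
    show "\<forall>\<^sub>F \<alpha> in ?l. sqrt ((\<eta> \<alpha>)\<^sup>2 * W \<alpha>) / (\<eta> \<alpha> * e \<alpha>)
        = sd (Q \<alpha>) (?V \<alpha>) / prob_space.expectation (Q \<alpha>) (?V \<alpha>)"
      using gauss eta_pos
    proof eventually_elim
      case (elim \<alpha>)
      have D: "0 < real CARD('n) - 1" using dim by simp
      have var: "prob_space.variance (Q \<alpha>) (?V \<alpha>) = W \<alpha> / (real CARD('n) - 1)\<^sup>2"
        unfolding gaussian_sample_variance(2)[OF elim(1)] W_def b_def m_def G_def ..
      have "prob_space.expectation (Q \<alpha>) (?V \<alpha>) = e \<alpha> / (real CARD('n) - 1)"
        unfolding gaussian_sample_variance(1)[OF elim(1)] e_def m_def G_def ..
      moreover have "sd (Q \<alpha>) (?V \<alpha>) = sqrt (W \<alpha>) / (real CARD('n) - 1)"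
        unfolding sd_def var using D by (simp add: real_sqrt_divide)
      ultimately show ?case using D elim(2) by (simp add: real_sqrt_mult)
    qed
  qed
  moreover have "\<exists>\<nu>1 \<nu>2. charpoly ?A = [:- \<nu>1, 1:] * [:- \<nu>2, 1:]"
    by (rule charpoly_symmetric_2_splits) (simp add: hopf_gram_def Let_def)
  moreover have "L = sqrt (2 * (\<nu>1\<^sup>2 + \<nu>2\<^sup>2)) / (\<nu>1 + \<nu>2)"
    if "charpoly ?A = [:- \<nu>1, 1:] * [:- \<nu>2, 1:]" for \<nu>1 \<nu>2
    using charpoly_2_roots[OF that] by (simp add: L_def)
  moreover have "1 \<le> L" "L \<le> sqrt 2"
    using gram_ratio_bounds[OF nonzero]
    by (simp_all add: L_def trace_hopf_gram trace_hopf_gram_sq Pp_def Pq_def p_def q_def)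
  ultimately show ?thesis unfolding Let_def L_def by blast
qed

end
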